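(* Let $\mathbb{F}$ be a field of characteristic different from $2$, let $n\ge 1$, let $E=E^{(n)}$ be the Grassmann algebra over $\mathbb{F}$ on $n$ generators, and write $k:=\lfloor n/4\rfloor$. (i) The maximal dimension of a commutative subalgebra of $E^{(n)}$ is $\dim(E^{(n)}_{\overline{0}})+|\mathcal{F}|$, where $\mathcal{F}\subseteq 2^{[n]}$ is an odd intersecting system of maximal possible size; so this maximal dimension equals \[ \begin{array}{ll} 3\cdot 2^{n-2} & \text{when } n \text{ is even};\\ 2^{n-1}+\sum_{l=k}^{2k}\binom{n}{2l+1} & \text{when } n=4k+1;\\ 2^{n-1}+\binom{n-1}{2k}+\sum_{l=k}^{2k}\binom{n}{2l+3} & \text{when } n=4k+3. \end{array} \] (ii) When $n$ is even, all maximal commutative subalgebras of $E^{(n)}$ have the same dimension, but they are not all isomorphic if $n>2$. (iii) When $n=4k+1$, there is a unique commutative subalgebra of $E^{(n)}$ of maximal dimension, namely $E_{\overline{0}}\oplus\bigoplus_{n/2<i,\ i\text{ odd}}E_i$. (iv) When $n=4k+3$, the commutative subalgebras of $E^{(n)}$ of maximal dimension are exactly the subspaces of the form $E_{\overline{0}}\oplus C\oplus\bigoplus_{n/2<i,\ i\text{ odd}}E_i$, where $C\subset E^{(n)}_{2k+1}$ is a square zero subspace of dimension $\binom{n-1}{2k}$. (v) When $n$ is odd, there exist maximal commutative subalgebras of $E^{(n)}$ that do not have the maximal possible dimension among commutative subalgebras of $E^{(n)}$.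
   Context: $E^{(n)}$ is the associative unital $\mathbb{F}$-algebra generated by $v_1,\dots,v_n$ subject to the relations $v_iv_j=-v_jv_i$ for $1\le i,j\le n$ (so $v_i^2=0$, since $\mathrm{char}\,\mathbb{F}\neq 2$). Write $[n]=\{1,\dots,n\}$. For $J=\{i_1<\dots<i_m\}\subseteq[n]$ put $v_J=v_{i_1}\cdots v_{i_m}$ (with $v_\emptyset=1$); the $v_J$, $J\subseteq[n]$, form an $\mathbb{F}$-basis of $E^{(n)}$. $E_m=E^{(n)}_m$ is the span of all $v_J$ with $|J|=m$, and $E_{\overline{0}}=E^{(n)}_{\overline{0}}=\bigoplus_{m\text{ even}}E_m$. A subspace $D\subseteq E$ is a square zero subspace if $cd=0$ for all $c,d\in D$. A commutative subalgebra of $E$ is called maximal if it is not properly contained in another commutative subalgebra of $E$. An odd intersecting system is a set $\mathcal{F}\subseteq 2^{[n]}$ of subsets of $[n]$ such that every $A\in\mathcal{F}$ has odd cardinality and $A\cap B\neq\emptyset$ for all $A,B\in\mathcal{F}$.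
   Formalization: Part (v) is stated for odd n ≥ 5 only: for n = 1 and n = 3 it is false, since every maximal commutative subalgebra of E^(n) then has the maximal dimension (2 and 6 respectively). *)

theory Defs
  imports
    Complex_Main
    "HOL-Library.Cardinality"
    "HOL-Library.Poly_Mapping"
    "HOL-Computational_Algebra.Computational_Algebra"
begin

section \<open>Free associative algebras\<close>

datatype 'a free_monoid = Letters "'a list"

instantiation free_monoid :: (type) monoid_add
begin

definition zero_free_monoid :: "'a free_monoid"
  where "0 = Letters []"

fun plus_free_monoid :: "'a free_monoid \<Rightarrow> 'a free_monoid \<Rightarrow> 'a free_monoid"
  where "Letters u + Letters w = Letters (u @ w)"

instance
proof
  fix u v w :: "'a free_monoid"
  show "u + v + w = u + (v + w)"
    by (cases u; cases v; cases w) simp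
  show "0 + u = u" and "u + 0 = u"
    by (cases u; simp add: zero_free_monoid_def)+
qed

end

text \<open>
  Since \<open>+\<close> on words is concatenation, the convolution product that the library puts on
  finitely supported functions makes this type the free associative unital algebra
  \<open>\<bbbF>\<langle>x\<^sub>i | i \<in> 'n\<rangle>\<close>.
\<close>

type_synonym ('a, 'n) free_algebra = "'n free_monoid \<Rightarrow>\<^sub>0 'a"

definition free_var :: "'n \<Rightarrow> ('a::field, 'n) free_algebra"
  where "free_var i = Poly_Mapping.single (Letters [i]) 1"

inductive_set two_sided_ideal :: "'r::ring_1 set \<Rightarrow> 'r set"
  for S :: "'r set" where
  zero: "0 \<in> two_sided_ideal S"
| base: "s \<in> S \<Longrightarrow> s \<in> two_sided_ideal S"
| add: "a \<in> two_sided_ideal S \<Longrightarrow> b \<in> two_sided_ideal S \<Longrightarrow> a + b \<in> two_sided_ideal S"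
| mult_left: "a \<in> two_sided_ideal S \<Longrightarrow> r * a \<in> two_sided_ideal S"
| mult_right: "a \<in> two_sided_ideal S \<Longrightarrow> a * r \<in> two_sided_ideal S"

lemma two_sided_ideal_uminus:
  assumes "a \<in> two_sided_ideal S"
  shows "- a \<in> two_sided_ideal S"
  using two_sided_ideal.mult_left[OF assms, of "- 1"] by simp

lemma two_sided_ideal_diff:
  assumes "a \<in> two_sided_ideal S" "b \<in> two_sided_ideal S"
  shows "a - b \<in> two_sided_ideal S"
  using two_sided_ideal.add[OF assms(1) two_sided_ideal_uminus[OF assms(2)]] by simp

definition anticommutation_relators :: "('a::field, 'n) free_algebra set"
  where "anticommutation_relators =
    {free_var i * free_var j + free_var j * free_var i | i j. True}"

lemma lookup_mult_zero:
  fixes p q :: "('a::field, 'n) free_algebra"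
  shows "Poly_Mapping.lookup (p * q) 0 = Poly_Mapping.lookup p 0 * Poly_Mapping.lookup q 0"
proof -
  have 0: "0 = l + m \<longleftrightarrow> l = 0 \<and> m = 0" for l m :: "'n free_monoid"
    by (cases l; cases m) (auto simp: zero_free_monoid_def)
  have "Poly_Mapping.lookup p l * (\<Sum>m. Poly_Mapping.lookup q m when 0 = l + m) =
      (Poly_Mapping.lookup p 0 * Poly_Mapping.lookup q 0 when l = 0)" for l
    by (cases "l = 0") (simp_all add: 0)
  then show ?thesis
    by (simp add: lookup_mult)
qed

lemma one_notin_relator_ideal:
  "(1 :: ('a::field, 'n) free_algebra) \<notin> two_sided_ideal anticommutation_relators"
proof -
  have free_var_0: "Poly_Mapping.lookup (free_var i :: ('a, 'n) free_algebra) 0 = 0" for i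
    by (simp add: free_var_def lookup_single zero_free_monoid_def)
  have "Poly_Mapping.lookup p 0 = 0"
    if "p \<in> two_sided_ideal (anticommutation_relators :: ('a, 'n) free_algebra set)" for p
    using that
  proof induction
    case (base s)
    then show ?case
      by (auto simp: anticommutation_relators_def lookup_add lookup_mult_zero free_var_0)
  qed (simp_all add: lookup_add lookup_mult_zero)
  from this[of 1] show ?thesis
    by auto
qed

lemma single_zero_commutes:
  fixes p :: "('a::field, 'n) free_algebra"
  shows "Poly_Mapping.single 0 c * p = p * Poly_Mapping.single 0 c"
proof (induction p rule: update_induct)
  case (update f a b)
  have "Poly_Mapping.update a b f = f + Poly_Mapping.single a b"
    using update.hyps(1)
    by (intro poly_mapping_eqI)
      (auto simp: lookup_add lookup_update lookup_single in_keys_iff when_def)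
  then show ?case
    using update.IH by (simp add: algebra_simps mult_single)
qed simp


section \<open>The Grassmann algebra\<close>

text \<open>The generators are indexed by \<open>'n\<close>, so that \<open>('a, 'n) grassmann\<close> is the Grassmann
  algebra on \<open>CARD('n)\<close> generators over \<open>'a\<close>.\<close>

quotient_type (overloaded) ('a, 'n) grassmann = "('a::field, 'n) free_algebra" /
  "\<lambda>p q. p - q \<in> two_sided_ideal anticommutation_relators"
proof (rule equivpI)
  show "reflp (\<lambda>p q :: ('a, 'n) free_algebra. p - q \<in> two_sided_ideal anticommutation_relators)"
    by (rule reflpI) (simp add: two_sided_ideal.zero)
  show "symp (\<lambda>p q :: ('a, 'n) free_algebra. p - q \<in> two_sided_ideal anticommutation_relators)"
    by (rule sympI) (metis minus_diff_eq two_sided_ideal_uminus)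
  show "transp (\<lambda>p q :: ('a, 'n) free_algebra. p - q \<in> two_sided_ideal anticommutation_relators)"
  proof (rule transpI)
    fix p q r :: "('a, 'n) free_algebra"
    assume "p - q \<in> two_sided_ideal anticommutation_relators"
      and "q - r \<in> two_sided_ideal anticommutation_relators"
    from two_sided_ideal.add[OF this]
    show "p - r \<in> two_sided_ideal anticommutation_relators"
      by simp
  qed
qed

instantiation grassmann :: (field, type) ring_1
begin

lift_definition zero_grassmann :: "('a, 'n) grassmann" is 0 .

lift_definition one_grassmann :: "('a, 'n) grassmann" is 1 .

lift_definition plus_grassmann ::
  "('a, 'n) grassmann \<Rightarrow> ('a, 'n) grassmann \<Rightarrow> ('a, 'n) grassmann" is "(+)"
  by (simp add: add_diff_add two_sided_ideal.add)

lift_definition uminus_grassmann :: "('a, 'n) grassmann \<Rightarrow> ('a, 'n) grassmann" is uminus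
  by (metis minus_diff_minus two_sided_ideal_uminus)

lift_definition minus_grassmann ::
  "('a, 'n) grassmann \<Rightarrow> ('a, 'n) grassmann \<Rightarrow> ('a, 'n) grassmann" is "(-)"
proof -
  fix a b c d :: "('a, 'n) free_algebra"
  assume "a - b \<in> two_sided_ideal anticommutation_relators"
    and "c - d \<in> two_sided_ideal anticommutation_relators"
  from two_sided_ideal_diff[OF this]
  show "a - c - (b - d) \<in> two_sided_ideal anticommutation_relators"
    by (simp add: algebra_simps)
qed

lift_definition times_grassmann ::
  "('a, 'n) grassmann \<Rightarrow> ('a, 'n) grassmann \<Rightarrow> ('a, 'n) grassmann" is "(*)"
proof -
  fix a b c d :: "('a, 'n) free_algebra"
  assume "a - b \<in> two_sided_ideal anticommutation_relators"
    and "c - d \<in> two_sided_ideal anticommutation_relators"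
  then have "(a - b) * c + b * (c - d) \<in> two_sided_ideal anticommutation_relators"
    by (intro two_sided_ideal.add two_sided_ideal.mult_left two_sided_ideal.mult_right)
  then show "a * c - b * d \<in> two_sided_ideal anticommutation_relators"
    by (simp add: algebra_simps)
qed

instance
proof
  fix a b c :: "('a, 'n) grassmann"
  show "a + b + c = a + (b + c)"
    by transfer (simp add: algebra_simps two_sided_ideal.zero)
  show "a + b = b + a"
    by transfer (simp add: algebra_simps two_sided_ideal.zero)
  show "0 + a = a"
    by transfer (simp add: two_sided_ideal.zero)
  show "- a + a = 0"
    by transfer (simp add: two_sided_ideal.zero)
  show "a - b = a + - b"
    by transfer (simp add: two_sided_ideal.zero)
  show "a * b * c = a * (b * c)"
    by transfer (simp add: mult.assoc two_sided_ideal.zero)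
  show "(a + b) * c = a * c + b * c"
    by transfer (simp add: algebra_simps two_sided_ideal.zero)
  show "a * (b + c) = a * b + a * c"
    by transfer (simp add: algebra_simps two_sided_ideal.zero)
  show "1 * a = a"
    by transfer (simp add: two_sided_ideal.zero)
  show "a * 1 = a"
    by transfer (simp add: two_sided_ideal.zero)
  show "(0 :: ('a, 'n) grassmann) \<noteq> 1"
    by transfer (metis diff_0 minus_minus one_notin_relator_ideal two_sided_ideal_uminus)
qed

end

lift_definition grassmann_scale ::
  "'a::field \<Rightarrow> ('a, 'n) grassmann \<Rightarrow> ('a, 'n) grassmann" (infixr "*\<^sub>g" 75)
  is "\<lambda>c p. Poly_Mapping.single 0 c * p"
  by (metis right_diff_distrib two_sided_ideal.mult_left)

global_interpretation grassmann: vector_space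
  "grassmann_scale :: 'a::field \<Rightarrow> ('a, 'n) grassmann \<Rightarrow> ('a, 'n) grassmann"
proof
  fix c d :: 'a and x y :: "('a, 'n) grassmann"
  show "c *\<^sub>g (x + y) = c *\<^sub>g x + c *\<^sub>g y"
    by transfer (simp add: algebra_simps two_sided_ideal.zero)
  show "(c + d) *\<^sub>g x = c *\<^sub>g x + d *\<^sub>g x"
    by transfer (simp add: algebra_simps single_add two_sided_ideal.zero)
  show "c *\<^sub>g d *\<^sub>g x = (c * d) *\<^sub>g x"
    by transfer (simp add: mult_single two_sided_ideal.zero flip: mult.assoc)
  show "1 *\<^sub>g x = x"
    by transfer (simp add: two_sided_ideal.zero)
qed

lemma grassmann_scale_mult_left: "(c *\<^sub>g x) * y = c *\<^sub>g (x * y)"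
  by transfer (simp add: mult.assoc two_sided_ideal.zero)

lemma grassmann_scale_mult_right: "x * (c *\<^sub>g y) = c *\<^sub>g (x * y)"
proof transfer
  fix p q :: "('a, 'n) free_algebra" and c :: 'a
  have "p * (Poly_Mapping.single 0 c * q) = Poly_Mapping.single 0 c * (p * q)"
    unfolding mult.assoc[symmetric] single_zero_commutes[of c p] ..
  then show "p * (Poly_Mapping.single 0 c * q) - Poly_Mapping.single 0 c * (p * q)
      \<in> two_sided_ideal anticommutation_relators"
    by (simp add: two_sided_ideal.zero)
qed

lift_definition grassmann_gen :: "'n \<Rightarrow> ('a::field, 'n) grassmann" is free_var .

lemma grassmann_gen_anticommute:
  "grassmann_gen i * grassmann_gen j = - (grassmann_gen j * grassmann_gen i)"
  by transfer (auto simp: anticommutation_relators_def intro!: two_sided_ideal.base)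

definition grassmann_monom :: "'n::{finite,linorder} set \<Rightarrow> ('a::field, 'n) grassmann"
  where "grassmann_monom J = prod_list (map grassmann_gen (sorted_list_of_set J))"

definition grassmann_hom :: "nat \<Rightarrow> ('a::field, 'n::{finite,linorder}) grassmann set"
  where "grassmann_hom m = grassmann.span {grassmann_monom J | J. card J = m}"

definition subspace_sum ::
  "('a::field, 'n) grassmann set set \<Rightarrow> ('a, 'n) grassmann set"
  where "subspace_sum \<V> = grassmann.span (\<Union>\<V>)"

text \<open>The homogeneous components are independent because the \<open>grassmann_monom J\<close> form a
  basis; hence this sum and the following one are direct.\<close>

definition grassmann_even :: "('a::field, 'n::{finite,linorder}) grassmann set"
  where "grassmann_even = subspace_sum {grassmann_hom m | m. even m}"

definition grassmann_upper_odd :: "('a::field, 'n::{finite,linorder}) grassmann set"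
  where "grassmann_upper_odd = subspace_sum {grassmann_hom i | i. odd i \<and> CARD('n) < 2 * i}"


section \<open>Commutative subalgebras and odd intersecting systems\<close>

definition subalgebra :: "('a::field, 'n) grassmann set \<Rightarrow> bool"
  where "subalgebra A \<longleftrightarrow>
    grassmann.subspace A \<and> 1 \<in> A \<and> (\<forall>x\<in>A. \<forall>y\<in>A. x * y \<in> A)"

definition commutative_subalgebra :: "('a::field, 'n) grassmann set \<Rightarrow> bool"
  where "commutative_subalgebra A \<longleftrightarrow>
    subalgebra A \<and> (\<forall>x\<in>A. \<forall>y\<in>A. x * y = y * x)"

definition maximal_commutative_subalgebra :: "('a::field, 'n) grassmann set \<Rightarrow> bool"
  where "maximal_commutative_subalgebra A \<longleftrightarrow>
    commutative_subalgebra A \<and> \<not> (\<exists>B. commutative_subalgebra B \<and> A \<subset> B)"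

definition isomorphic_subalgebras ::
  "('a::field, 'n) grassmann set \<Rightarrow> ('a, 'n) grassmann set \<Rightarrow> bool"
  where "isomorphic_subalgebras A B \<longleftrightarrow>
    (\<exists>f. bij_betw f A B \<and> f 1 = 1 \<and>
      (\<forall>x\<in>A. \<forall>y\<in>A. f (x + y) = f x + f y \<and> f (x * y) = f x * f y) \<and>
      (\<forall>c. \<forall>x\<in>A. f (c *\<^sub>g x) = c *\<^sub>g f x))"

definition square_zero_subspace :: "('a::field, 'n) grassmann set \<Rightarrow> bool"
  where "square_zero_subspace D \<longleftrightarrow>
    grassmann.subspace D \<and> (\<forall>c\<in>D. \<forall>d\<in>D. c * d = 0)"

definition odd_intersecting_system :: "'n set set \<Rightarrow> bool"
  where "odd_intersecting_system F \<longleftrightarrow>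
    (\<forall>A\<in>F. odd (card A)) \<and> (\<forall>A\<in>F. \<forall>B\<in>F. A \<inter> B \<noteq> {})"

end

theory Submission
  imports Defs "HOL-Library.Nat_Bijection"
begin

text \<open>
  Even elements are central. Hence a commutative subalgebra can be enlarged to one that contains
  the even part, and such an algebra is the direct sum of the even part and its own odd part \<open>D\<close>.
  Odd elements anticommute and \<open>2 \<noteq> 0\<close>, so two odd elements commute exactly if their product is
  zero. Everything is therefore a question about square zero subspaces \<open>D\<close> of the odd part that
  are stable under multiplication by even elements (\<open>odd_part_of_commutative\<close>,
  \<open>commutative_subalgebra_with_even\<close>).

  \<^emph>\<open>Dimension.\<close> Order the monomials by an injective weight on sets that is additive on disjoint
  unions. If the initial sets of \<open>c\<close> and \<open>d\<close> are disjoint, then the product of the two initial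
  terms survives in \<open>c d\<close>. So the initial sets of a square zero subspace form an odd intersecting
  system, and their number bounds the dimension (\<open>square_zero_initial_system\<close>). Conversely, an
  odd intersecting system that is closed under odd supersets spans a suitable \<open>D\<close>. The maximal
  dimension is thus a number about set systems. For even \<open>n\<close>, at most one set of each
  complementary pair can occur. For odd \<open>n\<close>, the members of size below \<open>(n - 1) / 2\<close> exclude
  strictly more large sets than they are (\<open>lower_sets_fewer_than_excluded\<close>), and those of size
  exactly \<open>(n - 1) / 2\<close> are counted by Katona's cycle argument (\<open>erdos_ko_rado_near_half\<close>).

  \<^emph>\<open>Odd \<open>n\<close>.\<close> The weight compares cardinalities first. If \<open>D\<close> has maximal dimension, its initial
  sets form a largest system, which has no member of size below \<open>(n - 1) / 2\<close>; so all of \<open>D\<close>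
  lies in degrees at least \<open>(n - 1) / 2\<close>. Everything odd of degree above \<open>n / 2\<close> annihilates the odd
  elements of these degrees and is contained in \<open>D\<close> by maximality (\<open>max_commutative_odd_part\<close>). This leaves only the
  degree \<open>(n - 1) / 2\<close> undetermined, and it is an odd degree only for \<open>n = 4 k + 3\<close>.

  \<^emph>\<open>Even \<open>n\<close>.\<close> The coefficient of the top monomial in \<open>c d\<close> is a pairing on the odd part, and a
  maximal \<open>D\<close> is equal to its own orthogonal complement (\<open>maximal_self_perp\<close>); so it has half the
  dimension of the odd part.

  \<^emph>\<open>Stars.\<close> The odd sets through a fixed point \<open>a\<close> always give a maximal commutative subalgebra,
  because an element annihilated by \<open>v\<^sub>a\<close> is a multiple of \<open>v\<^sub>a\<close>. For odd \<open>n \<ge> 5\<close> it is too small,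
  since its system contains \<open>{a}\<close>. For even \<open>n > 2\<close>, replacing \<open>{a}\<close> by its complement gives
  another maximal algebra. The two are distinguished by the dimension of the square of the
  augmentation ideal (\<open>star_algebras_not_isomorphic\<close>).
\<close>


section \<open>Odd intersecting systems of sets\<close>

lemma card_Compl_UNIV: "card (- A) = CARD('n) - card A" for A :: "'n::finite set"
  by (simp add: Compl_eq_Diff_UNIV card_Diff_subset)

lemma card_le_CARD: "card A \<le> CARD('n)" for A :: "'n::finite set"
  by (rule card_mono) simp_all

lemma card_UNIV_set: "card (UNIV :: 'n::finite set set) = 2 ^ CARD('n)"
  using card_Pow[of "UNIV :: 'n set"] by simp

lemma card_even_sets: "card {J :: 'n::finite set. even (card J)} = 2 ^ (CARD('n) - 1)"
  and card_odd_sets: "card {J :: 'n::finite set. odd (card J)} = 2 ^ (CARD('n) - 1)"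
proof -
  have eq: "card {J :: 'n set. even (card J)} = card {J :: 'n set. odd (card J)}"
    using card_subsupersets_even_odd[of "UNIV :: 'n set" "{}"] by (simp add: psubset_eq)
  have "card ({J :: 'n set. even (card J)} \<union> {J. odd (card J)}) =
      card {J :: 'n set. even (card J)} + card {J :: 'n set. odd (card J)}"
    by (rule card_Un_disjoint) auto
  moreover have "{J :: 'n set. even (card J)} \<union> {J. odd (card J)} = UNIV"
    by auto
  ultimately have "2 * card {J :: 'n set. even (card J)} = 2 ^ CARD('n)"
    using eq card_UNIV_set by simp
  moreover obtain m where "CARD('n) = Suc m"
    using zero_less_card_finite[where 'a = 'n] gr0_implies_Suc by blast
  ultimately show "card {J :: 'n set. even (card J)} = 2 ^ (CARD('n) - 1)"
    by simp
  with eq show "card {J :: 'n set. odd (card J)} = 2 ^ (CARD('n) - 1)"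
    by simp
qed

definition odd_star :: "'n \<Rightarrow> 'n set set"
  where "odd_star a = {J. odd (card J) \<and> a \<in> J}"

text \<open>
  Among all supersets of \<open>{a}\<close> the even and the odd ones are equinumerous as soon as there is a
  second point to toggle.
\<close>

lemma card_odd_star:
  assumes "CARD('n::finite) \<ge> 2"
  shows "card (odd_star (a :: 'n)) = 2 ^ (CARD('n) - 2)"
proof -
  have "{a} \<noteq> UNIV"
    using assms by (metis One_nat_def Suc_1 card.empty card.insert empty_iff finite.emptyI not_less_eq_eq order_refl)
  then have eq: "card {J. a \<in> J \<and> even (card J)} = card (odd_star a)"
    using card_subsupersets_even_odd[of "UNIV :: 'n set" "{a}"] by (auto simp: odd_star_def conj_commute)
  have "card {J. a \<notin> J} = card (Pow (- {a}))"
    by (rule arg_cong[where f = card]) auto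
  also have "\<dots> = 2 ^ (CARD('n) - 1)"
    by (simp add: card_Pow card_Compl_UNIV)
  finally have out: "card {J. a \<notin> J} = 2 ^ (CARD('n) - 1)" .
  have "UNIV = {J. a \<notin> J} \<union> ({J. a \<in> J \<and> even (card J)} \<union> odd_star a)"
    by (auto simp: odd_star_def)
  then have "card (UNIV :: 'n set set) = card ({J. a \<notin> J} \<union> ({J. a \<in> J \<and> even (card J)} \<union> odd_star a))"
    by simp
  also have "\<dots> = card {J. a \<notin> J} + (card {J. a \<in> J \<and> even (card J)} + card (odd_star a))"
    by (subst card_Un_disjoint | auto simp: odd_star_def)+
  finally have "2 ^ CARD('n) = 2 ^ (CARD('n) - 1) + 2 * card (odd_star a)"
    by (simp add: card_UNIV_set out eq)
  moreover obtain m where "CARD('n) = Suc (Suc m)"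
    using assms by (metis Suc_1 add_Suc_shift le_Suc_ex plus_1_eq_Suc add_Suc)
  ultimately show ?thesis
    by simp
qed

lemma odd_intersecting_odd_star: "odd_intersecting_system (odd_star a)"
  by (auto simp: odd_intersecting_system_def odd_star_def)

text \<open>
  For even \<open>n\<close> complementation preserves odd cardinality, and a set and its complement are
  disjoint.
\<close>

lemma odd_intersecting_card_even:
  assumes "odd_intersecting_system (F :: 'n::finite set set)" "even CARD('n)"
  shows "card F \<le> 2 ^ (CARD('n) - 2)"
proof -
  have "odd (card (- A))" if "A \<in> F" for A
    using that assms card_le_CARD[of A] by (simp add: card_Compl_UNIV odd_intersecting_system_def)
  then have "F \<union> uminus ` F \<subseteq> {J. odd (card J)}"
    using assms by (auto simp: odd_intersecting_system_def)
  then have "card (F \<union> uminus ` F) \<le> 2 ^ (CARD('n) - 1)"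
    using card_mono[of "{J :: 'n set. odd (card J)}"] card_odd_sets[where 'n = 'n] by simp
  moreover have "F \<inter> uminus ` F = {}"
    using assms(1) by (fastforce simp: odd_intersecting_system_def)
  ultimately have "2 * card F \<le> 2 ^ (CARD('n) - 1)"
    by (simp add: card_Un_disjoint card_image inj_on_def mult_2)
  moreover obtain m where "CARD('n) = Suc (Suc m)"
    using assms(2) zero_less_card_finite[where 'a = 'n]
    by (metis One_nat_def Suc_pred odd_one not_gr_zero even_zero dvd_def even_Suc)
  ultimately show ?thesis
    by simp
qed

definition upper_odd_sets :: "'n set set"
  where "upper_odd_sets = {J. odd (card J) \<and> CARD('n) < 2 * card J}"

lemma card_almost_full_subsets:
  assumes "finite S" "S \<noteq> {}"
  shows "card {B. B \<subseteq> S \<and> Suc (card B) = card S} = card S"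
proof -
  obtain m where m: "card S = Suc m"
    using assms by (metis card_gt_0_iff gr0_implies_Suc)
  have "card {B. B \<subseteq> S \<and> card B = m} = card S choose m"
    by (rule n_subsets[OF assms(1)])
  then show ?thesis
    by (simp add: m)
qed

text \<open>
  Join \<open>A\<close> to \<open>B\<close> if they are disjoint and together miss exactly one point. Then \<open>A\<close> has
  \<open>n - card A\<close> neighbours, while a neighbour \<open>B\<close> has only \<open>n - card B\<close>, which is smaller. Giving each
  edge at \<open>A\<close> the weight \<open>1 / (n - card A)\<close>, every \<open>A\<close> receives total weight 1 and every \<open>B\<close> less
  than 1. Missing one point, instead of taking \<open>B\<close> as the complement of \<open>A\<close>, keeps \<open>B\<close> of odd
  size when \<open>A\<close> has odd size and \<open>n\<close> is odd.
\<close>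

lemma lower_sets_fewer_than_excluded:
  fixes L :: "'n::finite set set"
  defines "N \<equiv> {B. \<exists>A\<in>L. A \<inter> B = {} \<and> card A + card B + 1 = CARD('n)}"
  assumes "L \<noteq> {}" and low: "\<And>A. A \<in> L \<Longrightarrow> 2 * card A + 1 < CARD('n)"
  shows "card L < card N"
proof -
  let ?R = "\<lambda>A B :: 'n set. A \<inter> B = {} \<and> card A + card B + 1 = CARD('n)"
  have deg: "card {B. ?R A B} = CARD('n) - card A" if "A \<noteq> UNIV" for A
  proof -
    have "{B. ?R A B} = {B. B \<subseteq> - A \<and> Suc (card B) = card (- A)}"
      using card_le_CARD[of A] by (auto simp: card_Compl_UNIV)
    then show ?thesis
      using card_almost_full_subsets[of "- A"] that by (auto simp: card_Compl_UNIV)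
  qed
  have "real (card L) = (\<Sum>A\<in>L. \<Sum>B | B \<in> N \<and> ?R A B. 1 / real (CARD('n) - card A))"
  proof -
    have "(\<Sum>B | B \<in> N \<and> ?R A B. 1 / real (CARD('n) - card A)) = 1" if "A \<in> L" for A
    proof -
      have "{B. B \<in> N \<and> ?R A B} = {B. ?R A B}"
        using that by (auto simp: N_def)
      moreover have "A \<noteq> UNIV" "CARD('n) - card A > 0"
        using low[OF that] by auto
      ultimately show ?thesis
        using deg[of A] by simp
    qed
    then have "(\<Sum>A\<in>L. \<Sum>B | B \<in> N \<and> ?R A B. 1 / real (CARD('n) - card A)) = (\<Sum>A\<in>L. 1)"
      by (rule sum.cong[OF refl])
    then show ?thesis
      by (simp only: sum_constant mult_1_right)
  qed
  also have "\<dots> = (\<Sum>B\<in>N. \<Sum>A | A \<in> L \<and> ?R A B. 1 / real (CARD('n) - card A))"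
    by (rule sum.swap_restrict) simp_all
  also have "\<dots> < (\<Sum>B\<in>N. 1)"
  proof (rule sum_strict_mono)
    obtain A where A: "A \<in> L"
      using \<open>L \<noteq> {}\<close> by blast
    have "card {B. ?R A B} > 0"
      using deg[of A] low[OF A] by fastforce
    then show "N \<noteq> {}"
      using A by (auto simp: N_def card_gt_0_iff)
    fix B assume "B \<in> N"
    then obtain A0 where A0: "A0 \<in> L" "?R A0 B"
      by (auto simp: N_def)
    then have big: "CARD('n) - card B < card B + 1" and "B \<noteq> UNIV"
      using low[OF A0(1)] by auto
    have "(\<Sum>A | A \<in> L \<and> ?R A B. 1 / real (CARD('n) - card A)) =
        (\<Sum>A | A \<in> L \<and> ?R A B. 1 / real (card B + 1))"
    proof (rule sum.cong)
      fix A assume "A \<in> {A. A \<in> L \<and> ?R A B}"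
      then have "CARD('n) - card A = card B + 1" by auto
      then show "1 / real (CARD('n) - card A) = 1 / real (card B + 1)" by simp
    qed simp
    also have "\<dots> = real (card {A. A \<in> L \<and> ?R A B}) / real (card B + 1)"
      by simp
    also have "\<dots> \<le> real (CARD('n) - card B) / real (card B + 1)"
    proof (intro divide_right_mono of_nat_mono)
      have "{A. A \<in> L \<and> ?R A B} \<subseteq> {A. ?R B A}"
        by auto
      then have "card {A. A \<in> L \<and> ?R A B} \<le> card {A. ?R B A}"
        by (intro card_mono) auto
      then show "card {A. A \<in> L \<and> ?R A B} \<le> CARD('n) - card B"
        using deg[OF \<open>B \<noteq> UNIV\<close>] by simp
    qed simp
    also have "\<dots> < 1"
      using big by (simp add: divide_less_eq_1)
    finally show "(\<Sum>A | A \<in> L \<and> ?R A B. 1 / real (CARD('n) - card A)) < 1" .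
  qed simp
  finally show ?thesis by simp
qed

text \<open>
  The members below size \<open>(n - 1) / 2\<close> are traded for the strictly more numerous sets above
  \<open>n / 2\<close> that they exclude.
\<close>

lemma odd_intersecting_card_odd:
  assumes F: "odd_intersecting_system (F :: 'n::finite set set)" and n: "odd CARD('n)"
  defines "M \<equiv> {J \<in> F. 2 * card J + 1 = CARD('n)}"
  shows "card F \<le> card M + card (upper_odd_sets :: 'n set set)"
    and "A \<in> F \<Longrightarrow> 2 * card A + 1 < CARD('n) \<Longrightarrow> card F < card M + card (upper_odd_sets :: 'n set set)"
proof -
  define L where "L = {J \<in> F. 2 * card J + 1 < CARD('n)}"
  define N where "N = {B. \<exists>A\<in>L. A \<inter> B = {} \<and> card A + card B + 1 = CARD('n)}"
  have N_upper: "N \<subseteq> upper_odd_sets"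
  proof
    fix B assume "B \<in> N"
    then obtain A where A: "A \<in> F" "2 * card A + 1 < CARD('n)" "card A + card B + 1 = CARD('n)"
      by (auto simp: N_def L_def)
    have "odd (card A)"
      using A F by (simp add: odd_intersecting_system_def)
    moreover have "odd (card A + card B + 1)"
      using n A by simp
    ultimately have "odd (card B)"
      by simp
    moreover have "CARD('n) < 2 * card B"
      using A(2,3) n by presburger
    ultimately show "B \<in> upper_odd_sets"
      by (simp add: upper_odd_sets_def)
  qed
  have "N \<inter> F = {}"
    using F by (auto simp: N_def L_def odd_intersecting_system_def)
  have trichotomy: "2 * card J + 1 < CARD('n) \<or> 2 * card J + 1 = CARD('n) \<or> CARD('n) < 2 * card J" for J :: "'n set"
    using n by presburger
  have "F \<subseteq> (L \<union> M) \<union> (upper_odd_sets - N)"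
    using F trichotomy \<open>N \<inter> F = {}\<close>
    by (auto simp: L_def M_def upper_odd_sets_def odd_intersecting_system_def)
  then have "card F \<le> card ((L \<union> M) \<union> (upper_odd_sets - N))"
    by (intro card_mono) auto
  also have "\<dots> \<le> card (L \<union> M) + card (upper_odd_sets - N)"
    by (rule card_Un_le)
  also have "\<dots> \<le> card L + card M + (card (upper_odd_sets :: 'n set set) - card N)"
    using N_upper by (simp add: card_Un_le card_Diff_subset)
  finally have le: "card F \<le> card L + card M + (card (upper_odd_sets :: 'n set set) - card N)" .
  have "card N \<le> card (upper_odd_sets :: 'n set set)"
    using N_upper by (intro card_mono) auto
  moreover have lt: "card L < card N" if "L \<noteq> {}"
    unfolding N_def by (rule lower_sets_fewer_than_excluded[OF that]) (simp add: L_def)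
  ultimately show "card F \<le> card M + card (upper_odd_sets :: 'n set set)"
    using le by (cases "L = {}") auto
  show "card F < card M + card (upper_odd_sets :: 'n set set)" if "A \<in> F" "2 * card A + 1 < CARD('n)"
  proof -
    have "L \<noteq> {}"
      using that by (auto simp: L_def)
    from lt[OF this] show ?thesis
      using le \<open>card N \<le> card (upper_odd_sets :: 'n set set)\<close> by simp
  qed
qed

text \<open>
  The permutation group acts transitively on the sets of a given size.
\<close>

lemma bij_image_count:
  fixes A B B' :: "'n::finite set"
  assumes "card B = card B'"
  shows "card {p. bij p \<and> p ` A = B} = card {p. bij p \<and> p ` A = B'}"
proof -
  obtain f where f: "bij_betw f B B'"
    using assms finite_same_card_bij[of B B'] by auto
  obtain g where g: "bij_betw g (- B) (- B')"
    using assms finite_same_card_bij[of "- B" "- B'"] by (auto simp: card_Compl_UNIV)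
  define q where "q x = (if x \<in> B then f x else g x)" for x
  have "bij_betw q B B'"
    using f by (subst bij_betw_cong[of B q f]) (simp_all add: q_def)
  moreover have "bij_betw q (- B) (- B')"
    using g by (subst bij_betw_cong[of "- B" q g]) (simp_all add: q_def)
  ultimately have "bij q" and qB: "q ` B = B'"
    using bij_betw_combine[of q B B' "- B" "- B'"] by (auto simp: bij_betw_def)
  have invq: "bij (inv q)" "inv q ` B' = B" "q \<circ> inv q = id" "inv q \<circ> q = id"
    using \<open>bij q\<close> qB
    by (simp_all add: bij_imp_bij_inv bij_is_inj bij_is_surj flip: surj_iff qB)
  show ?thesis
  proof (rule bij_betw_same_card[of "\<lambda>p. q \<circ> p"], rule bij_betw_byWitness[where f' = "\<lambda>p. inv q \<circ> p"])
    show "\<forall>p\<in>{p. bij p \<and> p ` A = B}. inv q \<circ> (q \<circ> p) = p"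
      "\<forall>p\<in>{p. bij p \<and> p ` A = B'}. q \<circ> (inv q \<circ> p) = p"
      using invq by (simp_all flip: comp_assoc)
    have "(q \<circ> p) ` A = B'" if "p ` A = B" for p
      using that qB by (simp only: image_comp[symmetric])
    then show "(\<circ>) q ` {p. bij p \<and> p ` A = B} \<subseteq> {p. bij p \<and> p ` A = B'}"
      using \<open>bij q\<close> by (blast intro: bij_comp)
    have "(inv q \<circ> p) ` A = B" if "p ` A = B'" for p
      using that invq(2) by (simp only: image_comp[symmetric])
    then show "(\<circ>) (inv q) ` {p. bij p \<and> p ` A = B'} \<subseteq> {p. bij p \<and> p ` A = B}"
      using invq(1) by (blast intro: bij_comp)
  qed
qed

lemma add_mod_left_cancel:
  fixes a b j n :: nat
  assumes "(j + a) mod n = (j + b) mod n" "a < n" "b < n"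
  shows "a = b"
  using assms
proof (induction a b rule: linorder_wlog)
  case (le a b)
  then have "n dvd (j + b) - (j + a)"
    using mod_eq_dvd_iff_nat[of "j + a" "j + b" n] by simp
  then show ?case
    using le nat_dvd_not_less[of "b - a" n] by (cases "a = b") auto
qed simp

lemma half_cycle_arcs_disjoint:
  fixes r j :: nat
  assumes "n = 2 * r + 1"
  shows "(\<lambda>t. (j + t) mod n) ` {..<r} \<inter> (\<lambda>t. ((j + r) mod n + t) mod n) ` {..<r} = {}"
proof (rule ccontr)
  assume "\<not> ?thesis"
  then obtain s t where st: "s < r" "t < r" "(j + s) mod n = (j + (r + t)) mod n"
    by (auto simp: mod_simps add.assoc)
  then show False
    using add_mod_left_cancel[OF st(3)] assms by simp
qed

text \<open>
  Katona's averaging argument, in the case \<open>n = 2 r + 1\<close>. Place the points on a cycle of length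
  \<open>n\<close>. The arc of length \<open>r\<close> that starts at \<open>j\<close> is disjoint from the one that starts at \<open>j + r\<close>. So the
  starting points of the arcs in \<open>F\<close> form a set that is disjoint from its translate by \<open>r\<close>, and
  there are at most \<open>r\<close> of them. Averaging over all permutations of the points gives the bound; here
  it is stated without division.
\<close>

lemma erdos_ko_rado_near_half:
  fixes F :: "'n::finite set set"
  assumes n: "CARD('n) = 2 * r + 1"
    and size: "\<And>A. A \<in> F \<Longrightarrow> card A = r"
    and meet: "\<And>A B. A \<in> F \<Longrightarrow> B \<in> F \<Longrightarrow> A \<inter> B \<noteq> {}"
  shows "CARD('n) * card F \<le> r * (CARD('n) choose r)"
proof -
  let ?n = "CARD('n)"
  obtain h :: "nat \<Rightarrow> 'n" where h: "bij_betw h {..<?n} UNIV"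
    using ex_bij_betw_nat_finite[of "UNIV :: 'n set"] by (auto simp: atLeast0LessThan)
  define arc where "arc j = h ` (\<lambda>t. (j + t) mod ?n) ` {..<r}" for j
  have inj_h: "inj_on h {..<?n}"
    using h by (simp add: bij_betw_def)
  have card_arc: "card (arc j) = r" for j
  proof -
    have "inj_on (\<lambda>t. (j + t) mod ?n) {..<r}"
    proof
      fix s t assume st: "s \<in> {..<r}" "t \<in> {..<r}" "(j + s) mod ?n = (j + t) mod ?n"
      then show "s = t"
        using add_mod_left_cancel[OF st(3)] n by simp
    qed
    then show ?thesis
      unfolding arc_def
      by (subst card_image) (auto simp: card_image intro!: inj_on_subset[OF inj_h])
  qed
  have arc_disjoint: "arc j \<inter> arc ((j + r) mod ?n) = {}" for j
  proof -
    have "(\<lambda>t. (j + t) mod ?n) ` {..<r} \<subseteq> {..<?n}"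
      "(\<lambda>t. ((j + r) mod ?n + t) mod ?n) ` {..<r} \<subseteq> {..<?n}"
      by auto
    from inj_on_image_Int[OF inj_h this] show ?thesis
      unfolding arc_def by (simp only: half_cycle_arcs_disjoint[OF n] image_empty)
  qed
  have few_arcs: "card {j \<in> {..<?n}. p ` arc j \<in> F} \<le> r" if "bij p" for p
  proof -
    let ?I = "{j \<in> {..<?n}. p ` arc j \<in> F}" and ?s = "\<lambda>j. (j + r) mod ?n"
    have "p ` arc j \<inter> p ` arc (?s j) = {}" for j
      using arc_disjoint[of j] \<open>bij p\<close> by (simp add: bij_is_inj flip: image_Int)
    then have disj: "?I \<inter> ?s ` ?I = {}"
      using meet by blast
    have "inj_on ?s {..<?n}"
    proof
      fix i j assume ij: "i \<in> {..<?n}" "j \<in> {..<?n}" "?s i = ?s j"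
      then show "i = j"
        using add_mod_left_cancel[of r i ?n j] by (simp add: add.commute)
    qed
    then have "card (?s ` ?I) = card ?I"
      by (intro card_image) (auto intro: inj_on_subset)
    then have "2 * card ?I = card (?I \<union> ?s ` ?I)"
      using disj by (simp add: card_Un_disjoint)
    also have "\<dots> \<le> card {..<?n}"
      by (intro card_mono) auto
    finally show ?thesis
      using n by simp
  qed
  have total: "card {p :: 'n \<Rightarrow> 'n. bij p \<and> p ` A \<in> G} = card G * card {p. bij p \<and> p ` A = A}"
    if "card A = r" "\<And>B. B \<in> G \<Longrightarrow> card B = r" for A :: "'n set" and G
  proof -
    have "{p :: 'n \<Rightarrow> 'n. bij p \<and> p ` A \<in> G} = (\<Union>B\<in>G. {p. bij p \<and> p ` A = B})"
      by auto
    then have "card {p :: 'n \<Rightarrow> 'n. bij p \<and> p ` A \<in> G} = (\<Sum>B\<in>G. card {p. bij p \<and> p ` A = B})"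
      by (simp only:) (rule card_UN_disjoint, auto)
    also have "\<dots> = (\<Sum>B\<in>G. card {p. bij p \<and> p ` A = A})"
      using that by (intro sum.cong refl bij_image_count) simp
    finally show ?thesis by simp
  qed
  let ?P = "card {p :: 'n \<Rightarrow> 'n. bij p}"
  have proportion: "(?n choose r) * card {p :: 'n \<Rightarrow> 'n. bij p \<and> p ` A \<in> F} = card F * ?P"
    if "card A = r" for A
  proof -
    have "{p :: 'n \<Rightarrow> 'n. bij p} = {p. bij p \<and> p ` A \<in> {B. card B = r}}"
      using that by (auto simp: card_image bij_is_inj inj_on_subset[of _ UNIV])
    then have "?P = card {B :: 'n set. card B = r} * card {p. bij p \<and> p ` A = A}"
      using total[OF that, of "{B. card B = r}"] by simp
    moreover have "card {B :: 'n set. card B = r} = (?n choose r)"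
      using n_subsets[of "UNIV :: 'n set" r] by simp
    ultimately show ?thesis
      using total[OF that, of F] size by simp
  qed
  have "?n * card F * ?P = (\<Sum>j<?n. (?n choose r) * card {p :: 'n \<Rightarrow> 'n. bij p \<and> p ` arc j \<in> F})"
    by (simp add: proportion[OF card_arc])
  also have "\<dots> = (?n choose r) * (\<Sum>j<?n. card {p \<in> {p :: 'n \<Rightarrow> 'n. bij p}. p ` arc j \<in> F})"
    by (simp add: sum_distrib_left)
  also have "(\<Sum>j<?n. card {p \<in> {p :: 'n \<Rightarrow> 'n. bij p}. p ` arc j \<in> F}) =
      (\<Sum>p | bij (p :: 'n \<Rightarrow> 'n). card {j \<in> {..<?n}. p ` arc j \<in> F})"
    using sum.swap_restrict[of "{..<?n}" "{p :: 'n \<Rightarrow> 'n. bij p}" "\<lambda>_ _. 1::nat" "\<lambda>j p. p ` arc j \<in> F"]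
    by simp
  also have "\<dots> \<le> (\<Sum>p | bij (p :: 'n \<Rightarrow> 'n). r)"
    by (intro sum_mono few_arcs) simp
  finally have "(?n * card F) * ?P \<le> (r * (?n choose r)) * ?P"
    by (simp add: algebra_simps)
  moreover have "?P > 0"
    by (auto simp: card_gt_0_iff intro!: exI[of _ id])
  ultimately show ?thesis
    by simp
qed

lemma card_sets_of_sizes:
  "finite I \<Longrightarrow> card {J :: 'n::finite set. card J \<in> I} = (\<Sum>i\<in>I. CARD('n) choose i)"
proof -
  assume "finite I"
  have "{J :: 'n set. card J \<in> I} = (\<Union>i\<in>I. {J. card J = i})"
    by auto
  then have "card {J :: 'n set. card J \<in> I} = (\<Sum>i\<in>I. card {J :: 'n set. card J = i})"
    by (simp only:) (rule card_UN_disjoint, auto simp: \<open>finite I\<close>)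
  also have "\<dots> = (\<Sum>i\<in>I. CARD('n) choose i)"
    using n_subsets[of "UNIV :: 'n set"] by simp
  finally show ?thesis .
qed

lemma card_upper_odd_sets_1_mod_4:
  assumes "CARD('n::finite) = 4 * k + 1"
  shows "card (upper_odd_sets :: 'n set set) = (\<Sum>l = k..2 * k. CARD('n) choose (2 * l + 1))"
proof -
  have "m \<in> (\<lambda>l. 2 * l + 1) ` {k..2 * k} \<longleftrightarrow> odd m \<and> 4 * k + 1 < 2 * m" if "m \<le> 4 * k + 1" for m
    using that by (auto simp: image_iff elim!: oddE)
  then have "(upper_odd_sets :: 'n set set) = {J. card J \<in> (\<lambda>l. 2 * l + 1) ` {k..2 * k}}"
    using card_le_CARD[where 'n = 'n] by (auto simp: upper_odd_sets_def assms)
  then have "card (upper_odd_sets :: 'n set set) = card {J :: 'n set. card J \<in> (\<lambda>l. 2 * l + 1) ` {k..2 * k}}"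
    by (rule arg_cong)
  also have "\<dots> = (\<Sum>i\<in>(\<lambda>l. 2 * l + 1) ` {k..2 * k}. CARD('n) choose i)"
    by (rule card_sets_of_sizes) simp
  also have "\<dots> = (\<Sum>l = k..2 * k. CARD('n) choose (2 * l + 1))"
    by (subst sum.reindex) (simp_all add: inj_on_def comp_def del: binomial_Suc_Suc)
  finally show ?thesis .
qed

lemma card_upper_odd_sets_3_mod_4:
  assumes "CARD('n::finite) = 4 * k + 3"
  shows "card (upper_odd_sets :: 'n set set) = (\<Sum>l = k..2 * k. CARD('n) choose (2 * l + 3))"
proof -
  have "m \<in> (\<lambda>l. 2 * l + 3) ` {k..2 * k} \<longleftrightarrow> odd m \<and> 4 * k + 3 < 2 * m" if "m \<le> 4 * k + 3" for m
  proof
    assume m: "odd m \<and> 4 * k + 3 < 2 * m"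
    then obtain i where i: "m = 2 * i + 1"
      by (auto elim: oddE)
    then have "m = 2 * (i - 1) + 3" "i - 1 \<in> {k..2 * k}"
      using m that by auto
    then show "m \<in> (\<lambda>l. 2 * l + 3) ` {k..2 * k}"
      by (rule image_eqI)
  qed auto
  then have "(upper_odd_sets :: 'n set set) = {J. card J \<in> (\<lambda>l. 2 * l + 3) ` {k..2 * k}}"
    using card_le_CARD[where 'n = 'n] by (auto simp: upper_odd_sets_def assms)
  then have "card (upper_odd_sets :: 'n set set) = card {J :: 'n set. card J \<in> (\<lambda>l. 2 * l + 3) ` {k..2 * k}}"
    by (rule arg_cong)
  also have "\<dots> = (\<Sum>i\<in>(\<lambda>l. 2 * l + 3) ` {k..2 * k}. CARD('n) choose i)"
    by (rule card_sets_of_sizes) simp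
  also have "\<dots> = (\<Sum>l = k..2 * k. CARD('n) choose (2 * l + 3))"
    by (subst sum.reindex) (simp_all add: inj_on_def comp_def del: binomial_Suc_Suc)
  finally show ?thesis .
qed

definition middle_star :: "'n \<Rightarrow> 'n set set"
  where "middle_star a = {J. a \<in> J \<and> 2 * card J + 1 = CARD('n)}"

lemma card_middle_star:
  assumes "CARD('n::finite) = 4 * k + 3"
  shows "card (middle_star (a :: 'n)) = (CARD('n) - 1) choose (2 * k)"
proof -
  have "bij_betw (insert a) {B. B \<subseteq> - {a} \<and> card B = 2 * k} (middle_star a)"
  proof (rule bij_betw_byWitness[where f' = "\<lambda>J. J - {a}"])
    show "insert a ` {B. B \<subseteq> - {a} \<and> card B = 2 * k} \<subseteq> middle_star a"
      using assms by (auto simp: middle_star_def card_insert_if)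
    show "(\<lambda>J. J - {a}) ` middle_star a \<subseteq> {B. B \<subseteq> - {a} \<and> card B = 2 * k}"
      using assms by (auto simp: middle_star_def)
  qed (auto simp: middle_star_def)
  then have "card (middle_star a) = card {B. B \<subseteq> - {a} \<and> card B = 2 * k}"
    by (simp add: bij_betw_same_card)
  also have "\<dots> = card (- {a}) choose (2 * k)"
    by (rule n_subsets) simp
  finally show ?thesis
    by (simp add: card_Compl_UNIV)
qed

text \<open>
  The bound of the Erdos--Ko--Rado theorem for sets of size \<open>2 k + 1\<close>, by the absorption identity
  for binomial coefficients.
\<close>

lemma card_middle_intersecting:
  assumes n: "CARD('n::finite) = 4 * k + 3" and F: "odd_intersecting_system (F :: 'n set set)"
  shows "card {J \<in> F. 2 * card J + 1 = CARD('n)} \<le> (CARD('n) - 1) choose (2 * k)"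
proof -
  let ?M = "{J \<in> F. 2 * card J + 1 = CARD('n)}"
  have "CARD('n) * card ?M \<le> (2 * k + 1) * (CARD('n) choose (2 * k + 1))"
    by (rule erdos_ko_rado_near_half) (use n F in \<open>auto simp: odd_intersecting_system_def\<close>)
  also have "\<dots> = CARD('n) * ((CARD('n) - 1) choose (2 * k))"
  proof -
    define m where "m = CARD('n) - 1"
    then have "CARD('n) = Suc m"
      using n by simp
    then show ?thesis
      using Suc_times_binomial_eq[of m "2 * k"]
      by (simp del: binomial_Suc_Suc mult_Suc mult_Suc_right)
  qed
  finally show ?thesis
    by simp
qed

definition max_system_size :: "nat \<Rightarrow> nat"
  where "max_system_size n =
    (if even n then 2 ^ (n - 2)
     else if n mod 4 = 1 then \<Sum>l = n div 4..2 * (n div 4). n choose (2 * l + 1)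
     else ((n - 1) choose (2 * (n div 4))) + (\<Sum>l = n div 4..2 * (n div 4). n choose (2 * l + 3)))"

lemma max_system_size_1_mod_4:
  assumes "n = 4 * k + 1"
  shows "max_system_size n = (\<Sum>l = k..2 * k. n choose (2 * l + 1))"
proof -
  have "odd n" "n mod 4 = 1" "n div 4 = k"
    using assms by simp_all
  then show ?thesis
    by (simp only: max_system_size_def if_True if_False refl)
qed

lemma max_system_size_3_mod_4:
  assumes "n = 4 * k + 3"
  shows "max_system_size n = ((n - 1) choose (2 * k)) + (\<Sum>l = k..2 * k. n choose (2 * l + 3))"
proof -
  have "odd n" "n mod 4 \<noteq> 1" "n div 4 = k"
    using assms by simp_all
  then show ?thesis
    by (simp only: max_system_size_def if_True if_False refl)
qed

lemma odd_mod_4_cases: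
  fixes n :: nat
  assumes "odd n"
  obtains k where "n = 4 * k + 1" | k where "n = 4 * k + 3"
proof -
  have "n = 4 * (n div 4) + 1 \<or> n = 4 * (n div 4) + 3"
    using assms by presburger
  then show thesis using that by blast
qed

text \<open>
  The second part is what makes the extremal systems for odd \<open>n\<close> rigid: a largest system has no
  member of size below \<open>(n - 1) / 2\<close>.
\<close>

lemma card_odd_intersecting_le:
  assumes F: "odd_intersecting_system (F :: 'n::finite set set)"
  shows "card F \<le> max_system_size CARD('n)"
    and "odd CARD('n) \<Longrightarrow> A \<in> F \<Longrightarrow> 2 * card A + 1 < CARD('n) \<Longrightarrow> card F < max_system_size CARD('n)"
proof -
  have odd_case: "card {J \<in> F. 2 * card J + 1 = CARD('n)} + card (upper_odd_sets :: 'n set set)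
      \<le> max_system_size CARD('n)" if "odd CARD('n)"
    using that
  proof (cases rule: odd_mod_4_cases)
    case (1 k)
    then have "{J \<in> F. 2 * card J + 1 = CARD('n)} = {}"
      using F by (auto simp: odd_intersecting_system_def)
    then show ?thesis
      unfolding max_system_size_1_mod_4[OF 1] card_upper_odd_sets_1_mod_4[OF 1] by (simp only: card.empty add_0)
  next
    case (2 k)
    show ?thesis
      unfolding max_system_size_3_mod_4[OF 2] card_upper_odd_sets_3_mod_4[OF 2]
      using card_middle_intersecting[OF 2 F] by simp
  qed
  show "card F \<le> max_system_size CARD('n)"
  proof (cases "even CARD('n)")
    case True
    then show ?thesis
      using odd_intersecting_card_even[OF F] by (simp add: max_system_size_def)
  next
    case False
    then show ?thesis
      using odd_intersecting_card_odd(1)[OF F] odd_case by linarith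
  qed
  show "card F < max_system_size CARD('n)"
    if "odd CARD('n)" "A \<in> F" "2 * card A + 1 < CARD('n)"
    using odd_intersecting_card_odd(2)[OF F that] odd_case[OF that(1)] by linarith
qed

text \<open>
  This is the property of a set system which makes the span of its monomials stable under
  multiplication by even elements.
\<close>

definition odd_upclosed :: "'n set set \<Rightarrow> bool"
  where "odd_upclosed F \<longleftrightarrow> (\<forall>A\<in>F. \<forall>B. A \<subseteq> B \<and> odd (card B) \<longrightarrow> B \<in> F)"

lemma odd_upclosed_odd_star: "odd_upclosed (odd_star a)"
  by (auto simp: odd_upclosed_def odd_star_def)

lemma odd_upclosed_upper: "odd_upclosed (upper_odd_sets :: 'n::finite set set)"
  unfolding odd_upclosed_def
proof (intro ballI allI impI)
  fix A B :: "'n set"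
  assume "A \<in> upper_odd_sets" "A \<subseteq> B \<and> odd (card B)"
  moreover from this have "card A \<le> card B"
    by (intro card_mono) auto
  ultimately show "B \<in> upper_odd_sets"
    by (simp add: upper_odd_sets_def)
qed

lemma large_sets_meet:
  assumes "CARD('n::finite) < card A + card (B :: 'n set)"
  shows "A \<inter> B \<noteq> {}"
proof
  assume "A \<inter> B = {}"
  then have "card (A \<union> B) = card A + card B"
    by (simp add: card_Un_disjoint)
  then show False
    using assms card_le_CARD[of "A \<union> B"] by simp
qed

lemma odd_intersecting_upper: "odd_intersecting_system (upper_odd_sets :: 'n::finite set set)"
  unfolding odd_intersecting_system_def
proof (intro conjI ballI)
  fix A B :: "'n set"
  assume "A \<in> upper_odd_sets" "B \<in> upper_odd_sets"
  then show "A \<inter> B \<noteq> {}"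
    by (intro large_sets_meet) (simp add: upper_odd_sets_def)
qed (simp add: upper_odd_sets_def)

text \<open>
  The witnesses are a star for even \<open>n\<close>, all odd sets above \<open>n / 2\<close> for \<open>n = 4 k + 1\<close>, and these
  together with a star of sets of size \<open>(n - 1) / 2\<close> for \<open>n = 4 k + 3\<close>.
\<close>

lemma odd_intersecting_max_exists:
  "\<exists>F :: 'n::finite set set. odd_intersecting_system F \<and> odd_upclosed F \<and> card F = max_system_size CARD('n)"
proof (cases "even CARD('n)")
  case True
  have "CARD('n) \<noteq> 0" "CARD('n) \<noteq> 1"
    using True by auto
  then have "2 \<le> CARD('n)"
    by linarith
  then have "card (odd_star (undefined :: 'n)) = max_system_size CARD('n)"
    using True by (simp add: card_odd_star max_system_size_def)
  then show ?thesis
    by (intro exI[of _ "odd_star undefined"] conjI odd_intersecting_odd_star odd_upclosed_odd_star)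
next
  case False
  then show ?thesis
  proof (cases rule: odd_mod_4_cases)
    case (1 k)
    have "card (upper_odd_sets :: 'n set set) = max_system_size CARD('n)"
      unfolding max_system_size_1_mod_4[OF 1] by (rule card_upper_odd_sets_1_mod_4[OF 1])
    then show ?thesis
      by (intro exI[of _ upper_odd_sets] conjI odd_intersecting_upper odd_upclosed_upper)
  next
    case (2 k)
    let ?a = "undefined :: 'n"
    let ?F = "middle_star ?a \<union> upper_odd_sets"
    have "odd_intersecting_system ?F"
      unfolding odd_intersecting_system_def
    proof (intro conjI ballI)
      fix A assume A: "A \<in> ?F"
      then show "odd (card A)"
        using 2 by (auto simp: middle_star_def upper_odd_sets_def) presburger
      fix B assume B: "B \<in> ?F"
      show "A \<inter> B \<noteq> {}"
      proof (cases "A \<in> middle_star ?a \<and> B \<in> middle_star ?a")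
        case True
        then show ?thesis by (auto simp: middle_star_def)
      next
        case False
        have *: "CARD('n) < card C + card D" if "C \<in> middle_star ?a" "D \<in> upper_odd_sets" for C D :: "'n set"
        proof -
          have "2 * card C + 1 = 4 * k + 3" "odd (card D)" "4 * k + 3 < 2 * card D"
            using that 2 by (auto simp: middle_star_def upper_odd_sets_def)
          then show ?thesis
            unfolding 2 by presburger
        qed
        have "CARD('n) < card A + card B"
          using A B False *[of A B] *[of B A] by (auto simp: upper_odd_sets_def)
        then show ?thesis
          by (rule large_sets_meet)
      qed
    qed
    moreover have "odd_upclosed ?F"
      unfolding odd_upclosed_def
    proof (intro ballI allI impI)
      fix A B assume A: "A \<in> ?F" and B: "A \<subseteq> B \<and> odd (card B)"
      show "B \<in> ?F"
      proof (cases "A \<in> middle_star ?a \<and> A \<noteq> B")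
        case True
        then have "card A < card B"
          using B by (intro psubset_card_mono) auto
        then have "CARD('n) < 2 * card B"
          using True by (auto simp: middle_star_def)
        then show ?thesis
          using B by (auto simp: upper_odd_sets_def)
      next
        case False
        then show ?thesis
          using A B odd_upclosed_upper unfolding odd_upclosed_def by blast
      qed
    qed
    moreover have "card ?F = max_system_size CARD('n)"
      unfolding max_system_size_3_mod_4[OF 2] card_upper_odd_sets_3_mod_4[OF 2, symmetric] card_middle_star[OF 2, of ?a, symmetric]
      by (rule card_Un_disjoint) (auto simp: middle_star_def upper_odd_sets_def)
    ultimately show ?thesis by blast
  qed
qed

lemma max_odd_intersecting_card:
  assumes "is_arg_max card odd_intersecting_system (F :: 'n::finite set set)"
  shows "card F = max_system_size CARD('n)"
proof -
  obtain G :: "'n set set" where "odd_intersecting_system G" "card G = max_system_size CARD('n)"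
    using odd_intersecting_max_exists by blast
  then have "\<not> card F < max_system_size CARD('n)" "odd_intersecting_system F"
    using assms by (auto simp: is_arg_max_def)
  then show ?thesis
    using card_odd_intersecting_le(1)[of F] by simp
qed

text \<open>
  The singleton \<open>{a}\<close> is the only member of the star at \<open>a\<close> that is disjoint from the complement
  of \<open>{a}\<close>, so one may be exchanged for the other.
\<close>

definition flipped_star :: "'n \<Rightarrow> 'n set set"
  where "flipped_star a = insert (- {a}) (odd_star a - {{a}})"

lemma flipped_star_system:
  fixes a :: "'n::finite"
  assumes "even CARD('n)" "CARD('n) > 2"
  shows "odd_intersecting_system (flipped_star a)" "odd_upclosed (flipped_star a)"
    "card (flipped_star a) = card (odd_star a)"
proof -
  have odd: "odd (card (- {a}))"
    using assms by (simp add: card_Compl_UNIV)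
  show "odd_intersecting_system (flipped_star a)"
    unfolding odd_intersecting_system_def
  proof (intro conjI ballI)
    show "odd (card A)" if "A \<in> flipped_star a" for A
      using that odd by (auto simp: flipped_star_def odd_star_def)
    show "A \<inter> B \<noteq> {}" if "A \<in> flipped_star a" "B \<in> flipped_star a" for A B
    proof -
      have "- {a} \<noteq> {}"
        using odd by (metis card.empty even_zero)
      moreover have "C \<inter> - {a} \<noteq> {}" if "C \<in> odd_star a - {{a}}" for C
        using that by (auto simp: odd_star_def)
      ultimately show ?thesis
        using that unfolding flipped_star_def by (auto simp: odd_star_def)
    qed
  qed
  show "odd_upclosed (flipped_star a)"
    unfolding odd_upclosed_def
  proof (intro ballI allI impI)
    fix A B assume A: "A \<in> flipped_star a" and B: "A \<subseteq> B \<and> odd (card B)"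
    show "B \<in> flipped_star a"
    proof (cases "A = - {a}")
      case True
      then have "B = - {a} \<or> B = UNIV"
        using B by auto
      then show ?thesis
        using B assms(1) by (auto simp: flipped_star_def)
    next
      case False
      then have "a \<in> A" "A \<noteq> {a}"
        using A by (auto simp: flipped_star_def odd_star_def)
      then have "a \<in> B" "B \<noteq> {a}"
        using B by auto
      then show ?thesis
        using B by (simp add: flipped_star_def odd_star_def)
    qed
  qed
  have "- {a} \<notin> odd_star a - {{a}}"
    by (simp add: odd_star_def)
  then have "card (flipped_star a) = Suc (card (odd_star a - {{a}}))"
    by (simp add: flipped_star_def)
  also have "\<dots> = card (odd_star a)"
    by (rule card_Suc_Diff1) (simp_all add: odd_star_def)
  finally show "card (flipped_star a) = card (odd_star a)" .
qed

text \<open>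
  Used to write a monomial as a product of two monomials of positive degree in the algebra of
  the star at \<open>a\<close>: split off two points different from \<open>a\<close>.
\<close>

lemma even_star_split:
  assumes J: "even (card J) \<and> 4 \<le> card J \<or> J \<in> odd_star a \<and> 3 \<le> card (J :: 'n::finite set)"
  obtains K L where "J = K \<union> L" "K \<inter> L = {}" "K \<noteq> {}" "L \<noteq> {}"
    "even (card K) \<or> K \<in> odd_star a" "even (card L)"
proof -
  have "2 \<le> card (J - {a})"
    using J card_Diff1_le[of J a] by (auto simp: card_Diff_singleton_if)
  then obtain L where L: "L \<subseteq> J - {a}" "card L = 2"
    by (rule obtain_subset_with_card_n)
  show thesis
  proof
    have "card (J - L) = card J - 2"
      using L by (subst card_Diff_subset) auto
    moreover have "a \<in> J - L \<longleftrightarrow> a \<in> J"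
      using L by auto
    ultimately show "even (card (J - L)) \<or> J - L \<in> odd_star a"
      using J by (auto simp: odd_star_def)
    show "J - L \<noteq> {}"
    proof
      assume "J - L = {}"
      then have "card (J - L) = 0" by simp
      then show False
        using \<open>card (J - L) = card J - 2\<close> J by auto
    qed
    show "L \<noteq> {}" "even (card L)"
      using L by auto
  qed (use L in auto)
qed

text \<open>
  A monomial order for the exterior algebra that compares degrees first. Numbering the points,
  the binary code of a set is additive and injective; adding a large multiple of the cardinality
  makes the order graded.
\<close>

lemma additive_set_weight:
  "\<exists>w :: 'n::finite set \<Rightarrow> nat. inj w \<and>
    (\<forall>J K. J \<inter> K = {} \<longrightarrow> w (J \<union> K) = w J + w K) \<and>
    (\<forall>J K. w J \<le> w K \<longrightarrow> card J \<le> card K)"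
proof -
  obtain idx :: "'n \<Rightarrow> nat" where idx: "inj idx"
    using finite_imp_inj_to_nat_seg[of "UNIV :: 'n set"] by auto
  define e where "e J = set_encode (idx ` J)" for J
  have e_add: "e (J \<union> K) = e J + e K" if "J \<inter> K = {}" for J K
  proof -
    have "idx ` J \<inter> idx ` K = {}"
      using that idx by (simp flip: image_Int)
    then show ?thesis
      unfolding e_def set_encode_def image_Un by (intro sum.union_disjoint) auto
  qed
  \<comment> \<open>The factor \<open>M\<close> exceeds all codes, so codes are residues modulo \<open>M\<close>.\<close>
  define M where "M = Suc (e UNIV)"
  define w where "w J = card J * M + e J" for J
  have e_less: "e J < M" for J
    using e_add[of J "- J"] by (simp add: M_def)
  show ?thesis
  proof (intro exI[of _ w] conjI allI impI)
    show "inj w"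
    proof
      fix J K assume "w J = w K"
      then have "w J mod M = w K mod M" by simp
      then have "e J = e K"
        using e_less by (simp add: w_def)
      then have "idx ` J = idx ` K"
        by (simp add: e_def set_encode_eq)
      then show "J = K"
        using idx by (simp add: inj_image_eq_iff)
    qed
    show "w (J \<union> K) = w J + w K" if "J \<inter> K = {}" for J K
      using that by (simp add: w_def e_add card_Un_disjoint algebra_simps)
    show "card J \<le> card K" if "w J \<le> w K" for J K
    proof -
      have "card J * M \<le> w K"
        using that by (simp add: w_def)
      also have "\<dots> < Suc (card K) * M"
        using e_less[of K] by (simp add: w_def)
      finally show ?thesis
        by (simp del: mult_Suc)
    qed
  qed
qed

section \<open>Coefficients with respect to the monomials\<close>

text \<open>
  Left multiplication by \<open>v\<^sub>i\<close>, expressed in terms of the coefficients of the ordered monomials.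
  Moving \<open>v\<^sub>i\<close> to its place in \<open>v\<^sub>J\<close> passes the generators with a smaller index.
\<close>

definition wedge_gen :: "'n::linorder \<Rightarrow> ('n set \<Rightarrow> 'a::field) \<Rightarrow> 'n set \<Rightarrow> 'a"
  where "wedge_gen i f J = (if i \<in> J then (-1) ^ card {j \<in> J. j < i} * f (J - {i}) else 0)"

lemma wedge_gen_linear:
  "wedge_gen i (\<lambda>K. f K + g K) = (\<lambda>J. wedge_gen i f J + wedge_gen i g J)"
  "wedge_gen i (\<lambda>K. c * f K) = (\<lambda>J. c * wedge_gen i f J)"
  "wedge_gen i (\<lambda>K. 0) = (\<lambda>J. 0)"
  by (auto simp: wedge_gen_def algebra_simps)

lemma wedge_gen_anticommute_less:
  fixes i j :: "'n::{finite,linorder}"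
  assumes "i < j"
  shows "wedge_gen i (wedge_gen j f) J + wedge_gen j (wedge_gen i f) J = 0"
proof (cases "i \<in> J \<and> j \<in> J")
  case True
  have 1: "{k \<in> J. k \<noteq> j \<and> k < i} = {k \<in> J. k < i}"
    using assms by auto
  have "{k \<in> J. k < j} = insert i {k \<in> J. k \<noteq> i \<and> k < j}"
    using assms True by auto
  then have "card {k \<in> J. k < j} = Suc (card {k \<in> J. k \<noteq> i \<and> k < j})"
    by (simp add: card_insert_disjoint)
  moreover have "J - {i} - {j} = J - {j} - {i}"
    by auto
  ultimately show ?thesis
    using True assms by (auto simp: wedge_gen_def 1)
qed (auto simp: wedge_gen_def)

lemma wedge_gen_anticommute:
  fixes i j :: "'n::{finite,linorder}"
  shows "wedge_gen i (wedge_gen j f) J + wedge_gen j (wedge_gen i f) J = 0"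
proof (cases i j rule: linorder_cases)
  case equal
  then show ?thesis by (simp add: wedge_gen_def)
qed (use wedge_gen_anticommute_less[of i j f J] wedge_gen_anticommute_less[of j i f J]
      in \<open>simp_all add: add.commute\<close>)

primrec letters :: "'n free_monoid \<Rightarrow> 'n list"
  where "letters (Letters u) = u"

lemma letters_add: "letters (u + w) = letters u @ letters w"
  by (cases u; cases w) simp

lemma letters_zero [simp]: "letters 0 = []"
  by (simp add: zero_free_monoid_def)

abbreviation wedge_word :: "'n::linorder free_monoid \<Rightarrow> ('n set \<Rightarrow> 'a::field) \<Rightarrow> 'n set \<Rightarrow> 'a"
  where "wedge_word u \<equiv> foldr wedge_gen (letters u)"

lemma foldr_wedge_gen_linear:
  "foldr wedge_gen u (\<lambda>K. f K + g K) = (\<lambda>J. foldr wedge_gen u f J + foldr wedge_gen u g J)"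
  "foldr wedge_gen u (\<lambda>K. c * f K) = (\<lambda>J. c * foldr wedge_gen u f J)"
  "foldr wedge_gen u (\<lambda>K. 0) = (\<lambda>J. 0)"
  by (induction u) (simp_all add: wedge_gen_linear)

text \<open>
  The representation of the free algebra on coefficient functions. It kills the anticommutation
  relators, so it descends to the Grassmann algebra. Evaluating it at the coefficient function of 1
  yields the coefficients, and this shows that the monomials are linearly independent.
\<close>

definition act :: "('a::field, 'n::linorder) free_algebra \<Rightarrow> ('n set \<Rightarrow> 'a) \<Rightarrow> 'n set \<Rightarrow> 'a"
  where "act p f J = (\<Sum>u. Poly_Mapping.lookup p u * wedge_word u f J)"

lemma act_eq_sum:
  assumes "finite S" "Poly_Mapping.keys p \<subseteq> S"
  shows "act p f J = (\<Sum>u\<in>S. Poly_Mapping.lookup p u * wedge_word u f J)"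
  unfolding act_def
  by (rule Sum_any.expand_superset) (use assms in \<open>auto simp: in_keys_iff\<close>)

lemma act_zero [simp]: "act 0 f = (\<lambda>J. 0)"
  by (simp add: act_def fun_eq_iff)

lemma act_add: "act (p + q) f = (\<lambda>J. act p f J + act q f J)"
proof
  fix J
  let ?S = "Poly_Mapping.keys p \<union> Poly_Mapping.keys q"
  have "Poly_Mapping.keys (p + q) \<subseteq> ?S" by (rule keys_add)
  then show "act (p + q) f J = act p f J + act q f J"
    using act_eq_sum[of ?S "p + q" f J] act_eq_sum[of ?S p f J] act_eq_sum[of ?S q f J]
    by (simp add: lookup_add algebra_simps sum.distrib)
qed

lemma act_single: "act (Poly_Mapping.single u c) f = (\<lambda>J. c * wedge_word u f J)"
  by (rule ext, subst act_eq_sum[of "{u}"]) auto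

lemma free_algebra_induct [case_names zero add_single]:
  fixes p :: "('a::field, 'n) free_algebra"
  assumes "P 0" "\<And>p u c. P p \<Longrightarrow> P (p + Poly_Mapping.single u c)"
  shows "P p"
proof (induction p rule: update_induct)
  case (update p u c)
  have "Poly_Mapping.update u c p = p + Poly_Mapping.single u c"
    using update.hyps(1)
    by (intro poly_mapping_eqI) (auto simp: lookup_add lookup_update lookup_single in_keys_iff when_def)
  then show ?case
    using update.IH assms(2) by simp
qed (rule assms(1))

lemma act_linear:
  "act p (\<lambda>K. f K + g K) = (\<lambda>J. act p f J + act p g J)"
  "act p (\<lambda>K. c * f K) = (\<lambda>J. c * act p f J)"
  "act p (\<lambda>K. 0) = (\<lambda>J. 0)"
  by (induction p rule: free_algebra_induct)
    (simp_all add: act_add act_single foldr_wedge_gen_linear algebra_simps)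

lemma act_mult: "act (p * q) f = act p (act q f)"
proof (induction p rule: free_algebra_induct)
  case (add_single p u c)
  have "act (Poly_Mapping.single u c * q) f = (\<lambda>J. c * wedge_word u (act q f) J)"
  proof (induction q rule: free_algebra_induct)
    case zero
    then show ?case by (simp add: foldr_wedge_gen_linear)
  next
    case (add_single q w d)
    then show ?case
      by (simp add: algebra_simps act_add act_single mult_single foldr_wedge_gen_linear letters_add)
  qed
  then show ?case
    using add_single.IH by (simp add: algebra_simps act_add act_single)
qed simp

lemma act_relator_ideal:
  fixes p :: "('a::field, 'n::{finite,linorder}) free_algebra"
  assumes "p \<in> two_sided_ideal anticommutation_relators"
  shows "act p f = (\<lambda>J. 0)"
  using assms
proof (induction arbitrary: f)
  case (base s)
  then obtain i j where "s = free_var i * free_var j + free_var j * free_var i"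
    by (auto simp: anticommutation_relators_def)
  then show ?case
    by (simp add: act_add act_mult free_var_def act_single wedge_gen_anticommute)
next
  case (mult_left a r)
  then show ?case by (simp add: act_mult act_linear)
qed (simp_all add: act_add act_mult)

text \<open>
  The coefficient function of 1 is 1 at the empty set and 0 elsewhere, so applying \<open>x\<close>
  to it gives the coefficients of \<open>x = x 1\<close>.
\<close>

lift_definition gcoeff :: "('a::field, 'n::{finite,linorder}) grassmann \<Rightarrow> 'n set \<Rightarrow> 'a"
  is "\<lambda>p. act p (\<lambda>K. if K = {} then 1 else 0)"
proof -
  fix p q :: "('a, 'n) free_algebra"
  assume "p - q \<in> two_sided_ideal anticommutation_relators"
  then have "act (p - q) (\<lambda>K. if K = {} then 1 else 0) = (\<lambda>J. 0)"
    by (rule act_relator_ideal)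
  then show "act p (\<lambda>K. if K = {} then 1 else 0) = act q (\<lambda>K. if K = {} then 1 else 0)"
    using act_add[of "p - q" q "\<lambda>K. if K = {} then 1 else 0"] by simp
qed

lemma gcoeff_add [simp]: "gcoeff (x + y) J = gcoeff x J + gcoeff y J"
  by transfer (simp add: act_add)

lemma gcoeff_zero [simp]: "gcoeff 0 J = 0"
  by transfer simp

lemma gcoeff_scale [simp]: "gcoeff (c *\<^sub>g x) J = c * gcoeff x J"
  by transfer (simp add: act_mult act_single)

lemma gcoeff_uminus [simp]: "gcoeff (- x) J = - gcoeff x J"
  using gcoeff_add[of x "- x" J] by (simp add: eq_neg_iff_add_eq_0 add.commute)

lemma gcoeff_diff [simp]: "gcoeff (x - y) J = gcoeff x J - gcoeff y J"
  using gcoeff_add[of x "- y" J] by simp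

lemma gcoeff_sum [simp]: "gcoeff (sum f S) J = (\<Sum>s\<in>S. gcoeff (f s) J)"
  by (induction S rule: infinite_finite_induct) simp_all

lemma gcoeff_gen_mult: "gcoeff (grassmann_gen i * x) = wedge_gen i (gcoeff x)"
  by transfer (simp add: act_mult free_var_def act_single)

lemma gcoeff_one: "gcoeff 1 J = (if J = {} then 1 else 0)"
  by transfer (simp add: act_single flip: single_one)

lemma gcoeff_prod_list_gen:
  assumes "sorted u" "distinct u"
  shows "gcoeff (prod_list (map grassmann_gen u)) J = (if J = set u then 1 else (0 :: 'a::field))"
  using assms
proof (induction u arbitrary: J)
  case (Cons i u)
  have "gcoeff (prod_list (map grassmann_gen u)) = (\<lambda>K. if K = set u then 1 else (0 :: 'a))"
    by (rule ext) (use Cons in simp)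
  then have step: "gcoeff (prod_list (map grassmann_gen (i # u))) J =
      wedge_gen i (\<lambda>K. if K = set u then 1 else (0 :: 'a)) J"
    by (simp add: gcoeff_gen_mult)
  show ?case
  proof (cases "J = insert i (set u)")
    case True
    have "{j \<in> J. j < i} = {}" "J - {i} = set u"
      using Cons.prems True by auto
    then show ?thesis
      unfolding step wedge_gen_def \<open>{j \<in> J. j < i} = {}\<close> using True by simp
  next
    case False
    then have "\<not> (i \<in> J \<and> J - {i} = set u)"
      by auto
    then show ?thesis
      unfolding step wedge_gen_def using False by auto
  qed
qed (simp add: gcoeff_one)

lemma gcoeff_monom: "gcoeff (grassmann_monom K) J = (if J = K then 1 else 0)"
  by (simp add: grassmann_monom_def gcoeff_prod_list_gen)

text \<open>
  The even part, the homogeneous components and the sum of the upper odd ones are spans of monomials.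
  Describing them by the support turns statements about them into statements about set systems.
\<close>

definition monom_space :: "'n set set \<Rightarrow> ('a::field, 'n::{finite,linorder}) grassmann set"
  where "monom_space F = {x. \<forall>J. gcoeff x J \<noteq> 0 \<longrightarrow> J \<in> F}"

lemma monom_spaceD: "x \<in> monom_space F \<Longrightarrow> J \<notin> F \<Longrightarrow> gcoeff x J = 0"
  by (auto simp: monom_space_def)

lemma subspace_monom_space: "grassmann.subspace (monom_space F)"
  unfolding grassmann.subspace_def monom_space_def by (auto; metis add_0)

lemma monom_in_monom_space: "grassmann_monom J \<in> monom_space F \<longleftrightarrow> J \<in> F"
  by (simp add: monom_space_def gcoeff_monom)

lemma monom_space_mono: "F \<subseteq> G \<Longrightarrow> monom_space F \<subseteq> monom_space G"
  by (auto simp: monom_space_def)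

lemma one_in_monom_space: "1 \<in> monom_space F \<longleftrightarrow> {} \<in> F"
  by (simp add: monom_space_def gcoeff_one)

lemma inj_grassmann_monom: "inj (grassmann_monom :: 'n::{finite,linorder} set \<Rightarrow> ('a::field, 'n) grassmann)"
proof
  fix J K :: "'n set"
  assume "grassmann_monom J = (grassmann_monom K :: ('a, 'n) grassmann)"
  then have "gcoeff (grassmann_monom J :: ('a, 'n) grassmann) J = gcoeff (grassmann_monom K :: ('a, 'n) grassmann) J"
    by simp
  then show "J = K"
    by (simp add: gcoeff_monom split: if_splits)
qed

lemma independent_monoms:
  "grassmann.independent (range grassmann_monom :: ('a::field, 'n::{finite,linorder}) grassmann set)"
  unfolding grassmann.independent_explicit_module
proof (intro allI impI)
  fix t u and v :: "('a, 'n) grassmann"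
  assume t: "finite t" "t \<subseteq> range grassmann_monom" "(\<Sum>w\<in>t. u w *\<^sub>g w) = 0" "v \<in> t"
  then obtain K where K: "v = grassmann_monom K" by blast
  have "(\<Sum>w\<in>t. u w * gcoeff w K) = (\<Sum>w\<in>t. if w = v then u w else 0)"
  proof (rule sum.cong)
    fix w assume "w \<in> t"
    then obtain L where "w = grassmann_monom L"
      using t by blast
    then show "u w * gcoeff w K = (if w = v then u w else 0)"
      by (simp add: K gcoeff_monom inj_eq[OF inj_grassmann_monom])
  qed simp
  also have "\<dots> = u v"
    using t by simp
  finally have "gcoeff (\<Sum>w\<in>t. u w *\<^sub>g w) K = u v"
    by simp
  then show "u v = 0"
    using t by simp
qed


section \<open>The monomial basis in characteristic different from two\<close>

text \<open>
  The parameter fixes the field and the index type, so that the monomials become a basis of one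
  fixed vector space.
\<close>

locale grassmann_char_neq_2 =
  fixes T :: "('a::field \<times> 'n::{finite,linorder}) itself"
  assumes two_neq_zero: "(2::'a) \<noteq> 0"
begin

abbreviation gen_word :: "'n list \<Rightarrow> ('a, 'n) grassmann"
  where "gen_word u \<equiv> prod_list (map grassmann_gen u)"

lemma eq_uminus_imp_zero:
  assumes "(x :: ('a, 'n) grassmann) = - x"
  shows "x = 0"
proof -
  have "x + x = 0"
    using assms by (simp add: eq_neg_iff_add_eq_0)
  then have "(2::'a) *\<^sub>g x = 0"
    using grassmann.scale_left_distrib[of 1 1 x] by simp
  then show ?thesis
    using two_neq_zero by simp
qed

lemma gen_square: "grassmann_gen i * grassmann_gen i = (0 :: ('a, 'n) grassmann)"
  by (rule eq_uminus_imp_zero) (rule grassmann_gen_anticommute)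

lemma gen_left_commute:
  "grassmann_gen i * (grassmann_gen j * x) = - (grassmann_gen j * (grassmann_gen i * (x :: ('a, 'n) grassmann)))"
proof -
  have "grassmann_gen i * (grassmann_gen j * x) = (grassmann_gen i * grassmann_gen j) * x"
    by (simp only: mult.assoc)
  also have "\<dots> = - (grassmann_gen j * grassmann_gen i) * x"
    by (simp only: grassmann_gen_anticommute[of i j])
  finally show ?thesis
    by (simp only: mult.assoc mult_minus_left)
qed

lemma gen_mult_word_repeated:
  "i \<in> set u \<Longrightarrow> grassmann_gen i * gen_word u = 0"
proof (induction u)
  case (Cons j u)
  then show ?case
  proof (cases "i = j")
    case True
    then show ?thesis
      by (simp add: gen_square flip: mult.assoc)
  next
    case False
    then show ?thesis
      using Cons by (simp add: gen_left_commute[of i j])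
  qed
qed simp

text \<open>
  The scalar is the sign of the permutation that sorts \<open>i\<close> into \<open>u\<close>.
\<close>

lemma gen_mult_word:
  "\<exists>c::'a. c \<noteq> 0 \<and> grassmann_gen i * gen_word u = c *\<^sub>g gen_word (insort i u)"
proof (induction u)
  case Nil
  show ?case by (rule exI[of _ 1]) simp
next
  case (Cons j u)
  then obtain c :: 'a where c: "c \<noteq> 0" "grassmann_gen i * gen_word u = c *\<^sub>g gen_word (insort i u)"
    by blast
  show ?case
  proof (cases "i \<le> j")
    case True
    then show ?thesis by (intro exI[of _ 1]) simp
  next
    case False
    then show ?thesis
      using c by (intro exI[of _ "- c"])
        (simp add: gen_left_commute[of i j] grassmann_scale_mult_right)
  qed
qed

lemma monom_word: "grassmann_monom J = gen_word (sorted_list_of_set J)"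
  by (simp add: grassmann_monom_def)

lemma gen_mult_monom_mem: "i \<in> J \<Longrightarrow> grassmann_gen i * grassmann_monom J = (0 :: ('a, 'n) grassmann)"
  unfolding monom_word by (rule gen_mult_word_repeated) simp

lemma gen_mult_monom:
  assumes "i \<notin> J"
  shows "\<exists>c::'a. c \<noteq> 0 \<and> grassmann_gen i * grassmann_monom J = c *\<^sub>g (grassmann_monom (insert i J) :: ('a, 'n) grassmann)"
proof -
  have "insort i (sorted_list_of_set J) = sorted_list_of_set (insert i J)"
    using assms by simp
  then show ?thesis
    using gen_mult_word[of i "sorted_list_of_set J"] unfolding monom_word by metis
qed

lemma monom_empty [simp]: "grassmann_monom {} = (1 :: ('a, 'n) grassmann)"
  by (simp add: grassmann_monom_def)

text \<open>
  The span of the monomials contains 1 and is stable under left multiplication by generators,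
  hence contains the images of all words.
\<close>

lemma monom_span_UNIV: "grassmann.span (range grassmann_monom) = (UNIV :: ('a, 'n) grassmann set)"
proof -
  let ?S = "grassmann.span (range grassmann_monom) :: ('a, 'n) grassmann set"
  have gen: "grassmann_gen i * x \<in> ?S" if "x \<in> ?S" for i x
    using that
  proof (induction rule: grassmann.span_induct_alt)
    case (step c x y)
    then obtain J where "x = grassmann_monom J" by blast
    have "grassmann_gen i * x \<in> ?S"
    proof (cases "i \<in> J")
      case True
      then show ?thesis
        by (simp add: \<open>x = grassmann_monom J\<close> gen_mult_monom_mem grassmann.span_zero)
    next
      case False
      then obtain d :: 'a where "grassmann_gen i * x = d *\<^sub>g grassmann_monom (insert i J)"
        using gen_mult_monom \<open>x = grassmann_monom J\<close> by blast
      then show ?thesis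
        by (simp add: grassmann.span_scale grassmann.span_base)
    qed
    then show ?case
      using step by (simp add: algebra_simps grassmann_scale_mult_right grassmann.span_add grassmann.span_scale)
  qed (simp add: grassmann.span_zero)
  have word: "abs_grassmann (Poly_Mapping.single (Letters u) 1) \<in> ?S" for u :: "'n list"
  proof (induction u)
    case Nil
    have "abs_grassmann (Poly_Mapping.single (Letters []) 1) = (1 :: ('a, 'n) grassmann)"
      by (simp add: one_grassmann_def flip: zero_free_monoid_def)
    moreover have "grassmann_monom {} \<in> ?S"
      by (intro grassmann.span_base rangeI)
    ultimately show ?case
      by simp
  next
    case (Cons i u)
    have "abs_grassmann (Poly_Mapping.single (Letters (i # u)) 1) =
        (grassmann_gen i * abs_grassmann (Poly_Mapping.single (Letters u) 1) :: ('a, 'n) grassmann)"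
      by (simp add: grassmann_gen.abs_eq times_grassmann.abs_eq free_var_def mult_single)
    then show ?case
      using gen[OF Cons] by simp
  qed
  have "abs_grassmann p \<in> ?S" for p
  proof (induction p rule: free_algebra_induct)
    case zero
    then show ?case by (simp add: grassmann.span_zero flip: zero_grassmann_def)
  next
    case (add_single p u c)
    obtain w where w: "u = Letters w" by (cases u)
    have "abs_grassmann (p + Poly_Mapping.single u c) =
        abs_grassmann p + c *\<^sub>g (abs_grassmann (Poly_Mapping.single (Letters w) 1) :: ('a, 'n) grassmann)"
      by (simp add: plus_grassmann.abs_eq grassmann_scale.abs_eq mult_single w)
    then show ?case
      using add_single word[of w] by (simp add: grassmann.span_add grassmann.span_scale)
  qed
  then have "x \<in> ?S" for x
    by (induction x rule: grassmann.abs_induct) simp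
  then show ?thesis
    by blast
qed

lemma grassmann_expansion:
  "x = (\<Sum>J\<in>UNIV. gcoeff x J *\<^sub>g grassmann_monom J)" for x :: "('a, 'n) grassmann"
proof -
  have "x \<in> grassmann.span (range grassmann_monom)"
    by (simp add: monom_span_UNIV)
  then show ?thesis
  proof (induction rule: grassmann.span_induct_alt)
    case (step c x y)
    then obtain K where K: "x = grassmann_monom K" by blast
    have "(\<Sum>J\<in>UNIV. gcoeff x J *\<^sub>g grassmann_monom J) = (\<Sum>J\<in>UNIV. if J = K then x else 0)"
      by (rule sum.cong) (auto simp: K gcoeff_monom)
    also have "\<dots> = x" by simp
    finally have "(\<Sum>J\<in>UNIV. gcoeff (c *\<^sub>g x + y) J *\<^sub>g grassmann_monom J) =
        c *\<^sub>g x + (\<Sum>J\<in>UNIV. gcoeff y J *\<^sub>g grassmann_monom J)"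
      by (simp add: grassmann.scale_left_distrib sum.distrib
          flip: grassmann.scale_scale grassmann.scale_sum_right)
    then show ?case
      using step by simp
  qed simp
qed

lemma grassmann_eqI: "(\<And>J. gcoeff x J = gcoeff y J) \<Longrightarrow> x = y" for x y :: "('a, 'n) grassmann"
  using grassmann_expansion[of x] grassmann_expansion[of y] by simp

lemma monom_mult_disjoint:
  "J \<inter> K = {} \<Longrightarrow>
    \<exists>c::'a. c \<noteq> 0 \<and> grassmann_monom J * grassmann_monom K = c *\<^sub>g (grassmann_monom (J \<union> K) :: ('a, 'n) grassmann)"
proof (induction J rule: finite_induct[OF finite])
  case 1
  show ?case by (auto intro!: exI[of _ 1])
next
  case (2 i J)
  obtain c :: 'a where c: "c \<noteq> 0" "grassmann_gen i * grassmann_monom J = c *\<^sub>g grassmann_monom (insert i J)"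
    using gen_mult_monom 2 by blast
  obtain d :: 'a where d: "d \<noteq> 0" "grassmann_monom J * grassmann_monom K = d *\<^sub>g grassmann_monom (J \<union> K)"
    using 2 by auto
  obtain e :: 'a where e: "e \<noteq> 0"
    "grassmann_gen i * grassmann_monom (J \<union> K) = e *\<^sub>g grassmann_monom (insert i (J \<union> K))"
    using gen_mult_monom[of i "J \<union> K"] 2 by auto
  have "grassmann_monom (insert i J) = inverse c *\<^sub>g (grassmann_gen i * grassmann_monom J)"
    using c by simp
  then have "grassmann_monom (insert i J) * grassmann_monom K =
      inverse c *\<^sub>g (grassmann_gen i * (grassmann_monom J * grassmann_monom K))"
    by (simp only: grassmann_scale_mult_left mult.assoc)
  also have "\<dots> = (inverse c * d * e) *\<^sub>g grassmann_monom (insert i J \<union> K)"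
    by (simp add: d e grassmann_scale_mult_right)
  finally show ?case
    using c d e by (intro exI[of _ "inverse c * d * e"]) simp
qed

text \<open>
  A common generator can be moved next to itself, and its square is zero.
\<close>

lemma monom_mult_meet:
  "J \<inter> K \<noteq> {} \<Longrightarrow> grassmann_monom J * grassmann_monom K = (0 :: ('a, 'n) grassmann)"
proof (induction J rule: finite_induct[OF finite])
  case (2 i J)
  obtain c :: 'a where c: "c \<noteq> 0" "grassmann_gen i * grassmann_monom J = c *\<^sub>g grassmann_monom (insert i J)"
    using gen_mult_monom 2 by blast
  have "grassmann_gen i * (grassmann_monom J * grassmann_monom K) = (0 :: ('a, 'n) grassmann)"
  proof (cases "J \<inter> K = {}")
    case True
    then obtain d :: 'a where "grassmann_monom J * grassmann_monom K = d *\<^sub>g grassmann_monom (J \<union> K)"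
      using monom_mult_disjoint by blast
    moreover have "i \<in> J \<union> K"
      using True 2 by auto
    ultimately show ?thesis
      by (simp add: grassmann_scale_mult_right gen_mult_monom_mem)
  qed (use 2 in simp)
  then have "c *\<^sub>g (grassmann_monom (insert i J) * grassmann_monom K) = 0"
    by (metis c(2) grassmann_scale_mult_left mult.assoc)
  then show ?case
    using c by simp
qed simp

lemma gen_word_mult_gen: "gen_word u * grassmann_gen i = (-1) ^ length u * (grassmann_gen i * gen_word u)"
proof (induction u)
  case (Cons j u)
  have "gen_word (j # u) * grassmann_gen i = grassmann_gen j * (gen_word u * grassmann_gen i)"
    by (simp add: mult.assoc)
  also have "\<dots> = (-1) ^ length u * (grassmann_gen j * (grassmann_gen i * gen_word u))"
    unfolding Cons by (cases "even (length u)") simp_all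
  also have "\<dots> = (-1) ^ length (j # u) * (grassmann_gen i * gen_word (j # u))"
    by (simp add: gen_left_commute[of j i])
  finally show ?case .
qed simp

lemma gen_word_commute:
  "gen_word u * gen_word w = (-1) ^ (length u * length w) * (gen_word w * gen_word u)"
proof (induction w)
  case (Cons i w)
  have "gen_word u * gen_word (i # w) = (gen_word u * grassmann_gen i) * gen_word w"
    by (simp add: mult.assoc)
  also have "\<dots> = (-1) ^ length u * (grassmann_gen i * (gen_word u * gen_word w))"
    unfolding gen_word_mult_gen by (simp add: mult.assoc)
  also have "\<dots> = (-1) ^ (length u + length u * length w) * (gen_word (i # w) * gen_word u)"
    unfolding Cons by (cases "even (length u)"; cases "even (length w)") (simp_all add: mult.assoc)
  finally show ?case
    by (simp add: algebra_simps)
qed simp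

lemma monom_commute:
  "grassmann_monom J * grassmann_monom K =
    (if odd (card J) \<and> odd (card K) then - (grassmann_monom K * grassmann_monom J)
     else (grassmann_monom K * grassmann_monom J :: ('a, 'n) grassmann))"
  using gen_word_commute[of "sorted_list_of_set J" "sorted_list_of_set K"]
  by (auto simp: monom_word)

sublocale fin: finite_dimensional_vector_space
  "grassmann_scale :: 'a \<Rightarrow> ('a, 'n) grassmann \<Rightarrow> ('a, 'n) grassmann" "range grassmann_monom"
proof
  show "finite (range grassmann_monom :: ('a, 'n) grassmann set)"
    by simp
qed (rule independent_monoms monom_span_UNIV)+

lemma monom_space_eq_span:
  "(monom_space F :: ('a, 'n) grassmann set) = grassmann.span (grassmann_monom ` F)"
proof
  show "(monom_space F :: ('a, 'n) grassmann set) \<subseteq> grassmann.span (grassmann_monom ` F)"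
  proof
    fix x :: "('a, 'n) grassmann"
    assume x: "x \<in> monom_space F"
    have "gcoeff x J *\<^sub>g grassmann_monom J \<in> grassmann.span (grassmann_monom ` F)" for J
    proof (cases "J \<in> F")
      case True
      then show ?thesis
        by (intro grassmann.span_scale grassmann.span_base imageI)
    next
      case False
      then show ?thesis
        by (simp add: monom_spaceD[OF x] grassmann.span_zero)
    qed
    then have "(\<Sum>J\<in>UNIV. gcoeff x J *\<^sub>g grassmann_monom J) \<in> grassmann.span (grassmann_monom ` F)"
      by (intro grassmann.span_sum)
    then show "x \<in> grassmann.span (grassmann_monom ` F)"
      by (simp flip: grassmann_expansion)
  qed
  show "grassmann.span (grassmann_monom ` F) \<subseteq> (monom_space F :: ('a, 'n) grassmann set)"
    by (intro grassmann.span_minimal subspace_monom_space) (auto simp: monom_in_monom_space)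
qed

lemma dim_monom_space: "grassmann.dim (monom_space F :: ('a, 'n) grassmann set) = card F"
proof -
  have "grassmann.independent (grassmann_monom ` F :: ('a, 'n) grassmann set)"
    by (rule grassmann.independent_mono[OF independent_monoms]) auto
  then have "grassmann.dim (monom_space F :: ('a, 'n) grassmann set) = card (grassmann_monom ` F :: ('a, 'n) grassmann set)"
    by (simp add: monom_space_eq_span grassmann.dim_eq_card_independent)
  also have "\<dots> = card F"
    by (intro card_image inj_on_subset[OF inj_grassmann_monom]) simp
  finally show ?thesis .
qed

lemma grassmann_hom_eq: "(grassmann_hom m :: ('a, 'n) grassmann set) = monom_space {J. card J = m}"
  unfolding grassmann_hom_def monom_space_eq_span by (rule arg_cong[where f = grassmann.span]) auto

lemma subspace_sum_hom:
  "subspace_sum {grassmann_hom m | m. P m} = (monom_space {J. P (card J)} :: ('a, 'n) grassmann set)"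
  unfolding subspace_sum_def
proof
  show "grassmann.span (\<Union> {grassmann_hom m |m. P m}) \<subseteq> (monom_space {J. P (card J)} :: ('a, 'n) grassmann set)"
    by (intro grassmann.span_minimal subspace_monom_space) (auto simp: grassmann_hom_eq monom_space_def)
  have "grassmann_monom ` {J. P (card J)} \<subseteq> (\<Union> {grassmann_hom m |m. P m} :: ('a, 'n) grassmann set)"
    by (auto simp: grassmann_hom_eq monom_in_monom_space)
  then show "(monom_space {J. P (card J)} :: ('a, 'n) grassmann set) \<subseteq> grassmann.span (\<Union> {grassmann_hom m |m. P m})"
    unfolding monom_space_eq_span by (rule grassmann.span_mono)
qed

abbreviation even_space :: "('a, 'n) grassmann set"
  where "even_space \<equiv> monom_space {J. even (card J)}"

abbreviation odd_space :: "('a, 'n) grassmann set"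
  where "odd_space \<equiv> monom_space {J. odd (card J)}"

lemma grassmann_even_eq: "(grassmann_even :: ('a, 'n) grassmann set) = even_space"
  unfolding grassmann_even_def by (rule subspace_sum_hom)

lemma grassmann_upper_odd_eq: "(grassmann_upper_odd :: ('a, 'n) grassmann set) = monom_space upper_odd_sets"
  unfolding grassmann_upper_odd_def upper_odd_sets_def by (rule subspace_sum_hom)

lemma dim_even_space: "grassmann.dim even_space = 2 ^ (CARD('n) - 1)"
  and dim_odd_space: "grassmann.dim odd_space = 2 ^ (CARD('n) - 1)"
  by (simp_all add: dim_monom_space card_even_sets card_odd_sets)

text \<open>
  The projection onto the span of the monomials in \<open>F\<close> along the other monomials.
\<close>

definition monom_part :: "'n set set \<Rightarrow> ('a, 'n) grassmann \<Rightarrow> ('a, 'n) grassmann"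
  where "monom_part F x = (\<Sum>J\<in>F. gcoeff x J *\<^sub>g grassmann_monom J)"

lemma gcoeff_monom_part: "gcoeff (monom_part F x) J = (if J \<in> F then gcoeff x J else 0)"
proof -
  have "gcoeff (monom_part F x) J = (\<Sum>K\<in>F. if K = J then gcoeff x J else 0)"
    unfolding monom_part_def gcoeff_sum by (rule sum.cong) (auto simp: gcoeff_monom)
  then show ?thesis by simp
qed

lemma monom_part_in: "monom_part F x \<in> monom_space F"
  by (simp add: monom_space_def gcoeff_monom_part)

lemma monom_part_add: "F \<inter> G = {} \<Longrightarrow> F \<union> G = UNIV \<Longrightarrow> monom_part F x + monom_part G x = x"
  by (rule grassmann_eqI) (auto simp: gcoeff_monom_part)

lemma even_odd_decomp:
  obtains e d where "e \<in> even_space" "d \<in> odd_space" "x = e + d"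
proof (rule that)
  show "x = monom_part {J. even (card J)} x + monom_part {J. odd (card J)} x"
    by (rule sym, rule monom_part_add) auto
qed (rule monom_part_in)+

lemma even_odd_disjoint: "x \<in> even_space \<Longrightarrow> x \<in> odd_space \<Longrightarrow> x = 0"
  by (rule grassmann_eqI) (auto simp: monom_space_def)

section \<open>Products in terms of coefficients\<close>

text \<open>
  For disjoint \<open>J\<close> and \<open>K\<close>, the sign by which \<open>v\<^sub>J v\<^sub>K\<close> differs from the monomial of the union.
\<close>

definition wedge_coeff :: "'n set \<Rightarrow> 'n set \<Rightarrow> 'a"
  where "wedge_coeff J K = gcoeff (grassmann_monom J * grassmann_monom K) (J \<union> K)"

lemma monom_mult:
  "grassmann_monom J * grassmann_monom K =
    (if J \<inter> K = {} then wedge_coeff J K *\<^sub>g grassmann_monom (J \<union> K) else 0)"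
proof (cases "J \<inter> K = {}")
  case True
  then obtain c :: 'a where "grassmann_monom J * grassmann_monom K = c *\<^sub>g grassmann_monom (J \<union> K)"
    using monom_mult_disjoint[OF True] by blast
  then show ?thesis
    using True by (simp add: wedge_coeff_def gcoeff_monom)
next
  case False
  then show ?thesis using monom_mult_meet[OF False] by simp
qed

lemma wedge_coeff_nonzero: "J \<inter> K = {} \<Longrightarrow> wedge_coeff J K \<noteq> 0"
  using monom_mult_disjoint[of J K] by (auto simp: wedge_coeff_def gcoeff_monom)

lemma mult_expansion:
  fixes x y :: "('a, 'n) grassmann"
  shows "x * y = (\<Sum>J\<in>UNIV. \<Sum>K\<in>UNIV. (gcoeff x J * gcoeff y K) *\<^sub>g (grassmann_monom J * grassmann_monom K))"
proof -
  have "x * y = (\<Sum>J\<in>UNIV. gcoeff x J *\<^sub>g grassmann_monom J) * (\<Sum>K\<in>UNIV. gcoeff y K *\<^sub>g grassmann_monom K)"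
    by (simp flip: grassmann_expansion)
  then show ?thesis
    by (simp add: sum_product grassmann_scale_mult_left grassmann_scale_mult_right mult.commute)
qed

lemma gcoeff_mult:
  "gcoeff (x * y) S = (\<Sum>J\<in>Pow S. gcoeff x J * gcoeff y (S - J) * wedge_coeff J (S - J))"
proof -
  have inner: "(\<Sum>K\<in>UNIV. gcoeff x J * gcoeff y K * gcoeff (grassmann_monom J * grassmann_monom K) S) =
      (if J \<subseteq> S then gcoeff x J * gcoeff y (S - J) * wedge_coeff J (S - J) else 0)" for J
  proof -
    have "(\<Sum>K\<in>UNIV. gcoeff x J * gcoeff y K * gcoeff (grassmann_monom J * grassmann_monom K) S) =
        (\<Sum>K\<in>UNIV. if K = S - J then (if J \<subseteq> S then gcoeff x J * gcoeff y K * wedge_coeff J K else 0) else 0)"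
    proof (rule sum.cong)
      fix K
      have "J \<inter> K = {} \<and> S = J \<union> K \<longleftrightarrow> K = S - J \<and> J \<subseteq> S"
        by auto
      then show "gcoeff x J * gcoeff y K * gcoeff (grassmann_monom J * grassmann_monom K) S =
          (if K = S - J then (if J \<subseteq> S then gcoeff x J * gcoeff y K * wedge_coeff J K else 0) else 0)"
        by (auto simp: monom_mult gcoeff_monom)
    qed simp
    then show ?thesis by simp
  qed
  have "gcoeff (x * y) S =
      (\<Sum>J\<in>UNIV. \<Sum>K\<in>UNIV. gcoeff x J * gcoeff y K * gcoeff (grassmann_monom J * grassmann_monom K) S)"
    by (subst mult_expansion) simp
  also have "\<dots> = (\<Sum>J\<in>UNIV. if J \<subseteq> S then gcoeff x J * gcoeff y (S - J) * wedge_coeff J (S - J) else 0)"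
    by (simp only: inner)
  also have "\<dots> = (\<Sum>J\<in>Pow S. gcoeff x J * gcoeff y (S - J) * wedge_coeff J (S - J))"
    by (simp add: sum.If_cases Pow_def)
  finally show ?thesis .
qed

lemma gcoeff_monom_mult:
  "gcoeff (grassmann_monom K * x) S = (if K \<subseteq> S then gcoeff x (S - K) * wedge_coeff K (S - K) else 0)"
proof -
  have "gcoeff (grassmann_monom K * x) S =
      (\<Sum>J\<in>Pow S. if J = K then gcoeff x (S - K) * wedge_coeff K (S - K) else 0)"
    unfolding gcoeff_mult by (rule sum.cong) (auto simp: gcoeff_monom)
  then show ?thesis by simp
qed

lemma mult_in_monom_space:
  assumes "x \<in> monom_space F" "y \<in> monom_space G"
    and "\<And>J K. J \<in> F \<Longrightarrow> K \<in> G \<Longrightarrow> J \<inter> K = {} \<Longrightarrow> J \<union> K \<in> H"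
  shows "x * y \<in> (monom_space H :: ('a, 'n) grassmann set)"
  unfolding monom_space_def
proof (intro CollectI allI impI)
  fix S assume "gcoeff (x * y) S \<noteq> 0"
  then obtain J where "J \<subseteq> S" "gcoeff x J * gcoeff y (S - J) * wedge_coeff J (S - J) \<noteq> 0"
    unfolding gcoeff_mult by (auto elim: sum.not_neutral_contains_not_neutral)
  then have "J \<in> F" "S - J \<in> G" "J \<union> (S - J) = S"
    using assms(1,2) by (auto simp: monom_space_def)
  then show "S \<in> H"
    using assms(3)[of J "S - J"] by auto
qed

lemma monom_space_empty: "monom_space {} = {0 :: ('a, 'n) grassmann}"
  by (auto simp: monom_space_def intro: grassmann_eqI)

lemma mult_eq_zero_if_meet:
  assumes "x \<in> monom_space F" "y \<in> monom_space G"
    and "\<And>J K. J \<in> F \<Longrightarrow> K \<in> G \<Longrightarrow> J \<inter> K \<noteq> {}"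
  shows "x * y = (0 :: ('a, 'n) grassmann)"
  using mult_in_monom_space[OF assms(1,2), of "{}"] assms(3) by (auto simp: monom_space_empty)

lemma even_mult_even: "x \<in> even_space \<Longrightarrow> y \<in> even_space \<Longrightarrow> x * y \<in> even_space"
  by (erule mult_in_monom_space) (auto simp: card_Un_disjoint)

lemma even_mult_odd: "x \<in> even_space \<Longrightarrow> y \<in> odd_space \<Longrightarrow> x * y \<in> odd_space"
  by (erule mult_in_monom_space) (auto simp: card_Un_disjoint)

lemma odd_mult_odd: "x \<in> odd_space \<Longrightarrow> y \<in> odd_space \<Longrightarrow> x * y \<in> even_space"
  by (erule mult_in_monom_space) (auto simp: card_Un_disjoint)

lemma even_commute:
  fixes x y :: "('a, 'n) grassmann"
  assumes "x \<in> even_space"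
  shows "x * y = y * x"
proof -
  have "(gcoeff x J * gcoeff y K) *\<^sub>g (grassmann_monom J * grassmann_monom K) =
      (gcoeff y K * gcoeff x J) *\<^sub>g (grassmann_monom K * grassmann_monom J :: ('a, 'n) grassmann)" for J K
  proof (cases "even (card J)")
    case True
    then show ?thesis
      by (simp add: monom_commute[of J K] mult.commute)
  next
    case False
    then show ?thesis
      using monom_spaceD[OF assms, of J] by simp
  qed
  then show ?thesis
    unfolding mult_expansion[of x y] mult_expansion[of y x]
    by (subst (2) sum.swap) (intro sum.cong refl)
qed

lemma odd_anticommute:
  fixes x y :: "('a, 'n) grassmann"
  assumes "x \<in> odd_space" "y \<in> odd_space"
  shows "x * y = - (y * x)"
proof -
  have "(gcoeff x J * gcoeff y K) *\<^sub>g (grassmann_monom J * grassmann_monom K) =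
      - ((gcoeff y K * gcoeff x J) *\<^sub>g (grassmann_monom K * grassmann_monom J :: ('a, 'n) grassmann))" for J K
  proof (cases "odd (card J) \<and> odd (card K)")
    case True
    then show ?thesis
      by (simp add: monom_commute[of J K] mult.commute)
  next
    case False
    then show ?thesis
      using monom_spaceD[OF assms(1), of J] monom_spaceD[OF assms(2), of K] by auto
  qed
  then show ?thesis
    unfolding mult_expansion[of x y] mult_expansion[of y x] sum_negf[symmetric]
    by (subst (2) sum.swap) (intro sum.cong refl)
qed

lemma odd_square: "x \<in> odd_space \<Longrightarrow> x * x = 0"
  by (rule eq_uminus_imp_zero) (rule odd_anticommute)

section \<open>Square zero subspaces of the odd part\<close>

text \<open>
  Such a \<open>D\<close> meets the span of the monomials outside \<open>F\<close> only in 0, and this span has codimension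
  \<open>card F\<close>.
\<close>

lemma dim_le_card_of_detecting_set:
  assumes D: "grassmann.subspace (D :: ('a, 'n) grassmann set)"
    and detect: "\<And>x. x \<in> D \<Longrightarrow> x \<noteq> 0 \<Longrightarrow> \<exists>J\<in>F. gcoeff x J \<noteq> 0"
  shows "grassmann.dim D \<le> card F"
proof -
  let ?W = "monom_space (- F) :: ('a, 'n) grassmann set"
  have "D \<inter> ?W \<subseteq> {0}"
    using detect by (fastforce simp: monom_space_def)
  then have "grassmann.dim (D \<inter> ?W) = 0"
    by (simp add: fin.dim_eq_0)
  then have "grassmann.dim {x + y |x y. x \<in> D \<and> y \<in> ?W} = grassmann.dim D + card (- F)"
    using fin.dim_sums_Int[OF D subspace_monom_space, of "- F"] by (simp add: dim_monom_space del: fin.dim_eq_0)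
  moreover have "grassmann.dim {x + y |x y. x \<in> D \<and> y \<in> ?W} \<le> grassmann.dim (monom_space UNIV :: ('a, 'n) grassmann set)"
    by (rule fin.dim_subset) (simp add: monom_space_def)
  moreover have "card F + card (- F) = card (UNIV :: 'n set set)"
    using card_Un_disjoint[of F "- F"] by (simp only: finite Compl_disjoint Compl_partition simp_thms)
  ultimately show ?thesis
    by (simp add: dim_monom_space)
qed

text \<open>
  \<open>F\<close> consists of the sets of least weight in the supports of the nonzero elements of \<open>D\<close>. If
  \<open>A\<close> and \<open>B\<close> are the initial sets of \<open>c\<close> and \<open>d\<close> and are disjoint, then by additivity no other pair of
  terms contributes to the coefficient of \<open>c d\<close> at the union of \<open>A\<close> and \<open>B\<close>, so \<open>c d\<close> is
  nonzero. The last property holds because the weight compares cardinalities first.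
\<close>

lemma square_zero_initial_system:
  assumes D: "grassmann.subspace D" "D \<subseteq> odd_space" and square_zero: "\<And>c d. c \<in> D \<Longrightarrow> d \<in> D \<Longrightarrow> c * d = 0"
  obtains F :: "'n set set" where "odd_intersecting_system F" "grassmann.dim D \<le> card F"
    "\<And>x J. x \<in> D \<Longrightarrow> gcoeff x J \<noteq> 0 \<Longrightarrow> \<exists>A\<in>F. card A \<le> card J"
proof -
  obtain w :: "'n set \<Rightarrow> nat" where w: "inj w"
    "\<And>J K. J \<inter> K = {} \<Longrightarrow> w (J \<union> K) = w J + w K"
    "\<And>J K. w J \<le> w K \<Longrightarrow> card J \<le> card K"
    using additive_set_weight[where 'n = 'n] by blast
  define init where "init x = arg_min w (\<lambda>J. gcoeff x J \<noteq> 0)" for x :: "('a, 'n) grassmann"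
  have init: "gcoeff x (init x) \<noteq> 0" "w (init x) \<le> w J" if "gcoeff x J \<noteq> 0" for x J
    using arg_min_nat_lemma[of "\<lambda>J. gcoeff x J \<noteq> 0" J w, OF that] that unfolding init_def by auto
  have nonzero: "\<exists>J. gcoeff x J \<noteq> 0" if "x \<noteq> 0" for x :: "('a, 'n) grassmann"
    using that grassmann_eqI[of x 0] by auto
  define F where "F = init ` (D - {0})"
  show thesis
  proof
    show "odd_intersecting_system F"
      unfolding odd_intersecting_system_def
    proof (intro conjI ballI)
      fix A assume "A \<in> F"
      then obtain c where c: "c \<in> D" "c \<noteq> 0" "A = init c"
        by (auto simp: F_def)
      have cA: "gcoeff c A \<noteq> 0"
        using nonzero[OF c(2)] init(1) c(3) by blast
      then show "odd (card A)"
        using c(1) D(2) by (auto simp: monom_space_def)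
      fix B assume "B \<in> F"
      then obtain d where d: "d \<in> D" "d \<noteq> 0" "B = init d"
        by (auto simp: F_def)
      have dB: "gcoeff d B \<noteq> 0"
        using nonzero[OF d(2)] init(1) d(3) by blast
      show "A \<inter> B \<noteq> {}"
      proof
        assume disj: "A \<inter> B = {}"
        then have SA: "A \<union> B - A = B"
          by auto
        have "gcoeff (c * d) (A \<union> B) =
            (\<Sum>J\<in>Pow (A \<union> B). if J = A then gcoeff c A * gcoeff d B * wedge_coeff A B else 0)"
          unfolding gcoeff_mult
        proof (rule sum.cong)
          fix J assume J: "J \<in> Pow (A \<union> B)"
          let ?K = "A \<union> B - J"
          show "gcoeff c J * gcoeff d ?K * wedge_coeff J ?K =
              (if J = A then gcoeff c A * gcoeff d B * wedge_coeff A B else 0)"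
          proof (cases "J = A")
            case True
            then show ?thesis by (simp add: SA)
          next
            case False
            have "gcoeff c J = 0 \<or> gcoeff d ?K = 0"
            proof (rule ccontr)
              assume "\<not> ?thesis"
              then have "w A \<le> w J" "w B \<le> w ?K"
                using init(2) c(3) d(3) by auto
              moreover have "w J + w ?K = w (J \<union> ?K)"
                by (rule w(2)[symmetric]) auto
              moreover have "J \<union> ?K = A \<union> B"
                using J by auto
              ultimately have "w J = w A"
                using w(2)[OF disj] by simp
              then show False
                using False w(1) by (simp add: inj_eq)
            qed
            then show ?thesis
              using False by auto
          qed
        qed simp
        also have "\<dots> = gcoeff c A * gcoeff d B * wedge_coeff A B"
          by simp
        also have "\<dots> \<noteq> 0"
          using cA dB wedge_coeff_nonzero[OF disj] by simp
        finally show False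
          using square_zero[OF c(1) d(1)] by simp
      qed
    qed
    show "grassmann.dim D \<le> card F"
    proof (rule dim_le_card_of_detecting_set[OF D(1)])
      fix x assume x: "x \<in> D" "x \<noteq> 0"
      obtain J where "gcoeff x J \<noteq> 0"
        using nonzero[OF x(2)] by blast
      then have "gcoeff x (init x) \<noteq> 0"
        by (rule init(1))
      moreover have "init x \<in> F"
        using x by (simp add: F_def)
      ultimately show "\<exists>J\<in>F. gcoeff x J \<noteq> 0"
        by (rule bexI)
    qed
    show "\<exists>A\<in>F. card A \<le> card J" if "x \<in> D" "gcoeff x J \<noteq> 0" for x J
    proof -
      have "x \<noteq> 0"
        using that(2) by auto
      then have "init x \<in> F"
        using that(1) by (simp add: F_def)
      moreover have "card (init x) \<le> card J"
        by (rule w(3)) (rule init(2)[OF that(2)])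
      ultimately show ?thesis by blast
    qed
  qed
qed

section \<open>Commutative subalgebras and their odd parts\<close>

text \<open>
  These are the odd parts of the commutative subalgebras that contain all even elements.
\<close>

definition odd_square_zero_module :: "('a, 'n) grassmann set \<Rightarrow> bool"
  where "odd_square_zero_module D \<longleftrightarrow> square_zero_subspace D \<and> D \<subseteq> odd_space \<and>
    (\<forall>e\<in>even_space. \<forall>d\<in>D. e * d \<in> D)"

abbreviation with_even :: "('a, 'n) grassmann set \<Rightarrow> ('a, 'n) grassmann set"
  where "with_even D \<equiv> {e + d | e d. e \<in> even_space \<and> d \<in> D}"

lemma odd_square_zero_moduleD:
  assumes "odd_square_zero_module D"
  shows "grassmann.subspace D" "D \<subseteq> odd_space" "\<And>c d. c \<in> D \<Longrightarrow> d \<in> D \<Longrightarrow> c * d = 0"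
    "\<And>e d. e \<in> even_space \<Longrightarrow> d \<in> D \<Longrightarrow> e * d \<in> D"
  using assms by (auto simp: odd_square_zero_module_def square_zero_subspace_def)

lemma commutative_subalgebra_with_even:
  assumes "odd_square_zero_module D"
  shows "commutative_subalgebra (with_even D)"
proof -
  note D = odd_square_zero_moduleD[OF assms]
  have prod: "(e + d) * (e' + d') = e * e' + (e * d' + e' * d)"
    if "e \<in> even_space" "d \<in> D" "e' \<in> even_space" "d' \<in> D" for e d e' d'
    using D(3)[OF that(2,4)] even_commute[OF that(3), of d] by (simp add: algebra_simps)
  have "0 \<in> D"
    using D(1) by (rule grassmann.subspace_0)
  have "grassmann.subspace (with_even D)"
    by (rule grassmann.subspace_sums[OF subspace_monom_space D(1)])
  moreover have "1 \<in> with_even D"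
    using \<open>0 \<in> D\<close> by (intro CollectI exI[of _ 1] exI[of _ 0]) (simp add: one_in_monom_space)
  moreover have "x * y \<in> with_even D \<and> x * y = y * x" if xy: "x \<in> with_even D" "y \<in> with_even D" for x y
  proof -
    obtain e d where x: "x = e + d" "e \<in> even_space" "d \<in> D"
      using xy by blast
    obtain e' d' where y: "y = e' + d'" "e' \<in> even_space" "d' \<in> D"
      using xy by blast
    have "x * y = e * e' + (e * d' + e' * d)"
      using prod[OF x(2,3) y(2,3)] x(1) y(1) by simp
    moreover have "e * e' \<in> even_space"
      using x(2) y(2) by (rule even_mult_even)
    moreover have "e * d' + e' * d \<in> D"
      using x y by (intro grassmann.subspace_add[OF D(1)] D(4))
    moreover have "y * x = e' * e + (e' * d + e * d')"
      using prod[OF y(2,3) x(2,3)] x(1) y(1) by simp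
    ultimately show ?thesis
      using even_commute[OF x(2), of e'] by (auto simp: add.commute)
  qed
  ultimately show ?thesis
    unfolding commutative_subalgebra_def subalgebra_def by blast
qed

lemma dim_with_even:
  assumes "grassmann.subspace D" "D \<subseteq> odd_space"
  shows "grassmann.dim (with_even D) = 2 ^ (CARD('n) - 1) + grassmann.dim D"
proof -
  have "even_space \<inter> D \<subseteq> {0}"
    using assms(2) even_odd_disjoint by blast
  then have "grassmann.dim (even_space \<inter> D) = 0"
    by (simp add: fin.dim_eq_0)
  then show ?thesis
    using fin.dim_sums_Int[OF subspace_monom_space assms(1), of "{J. even (card J)}"]
    by (simp add: dim_even_space del: fin.dim_eq_0)
qed

lemma commutative_subalgebraD:
  assumes "commutative_subalgebra A"
  shows "grassmann.subspace A" "1 \<in> A" "\<And>x y. x \<in> A \<Longrightarrow> y \<in> A \<Longrightarrow> x * y \<in> A"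
    "\<And>x y. x \<in> A \<Longrightarrow> y \<in> A \<Longrightarrow> x * y = y * x"
  using assms unfolding commutative_subalgebra_def subalgebra_def by blast+

text \<open>
  If \<open>x\<close> and \<open>y\<close> are odd and commute, then \<open>x y = - x y\<close>.
\<close>

lemma odd_part_of_commutative:
  assumes A: "commutative_subalgebra A" and even: "even_space \<subseteq> A"
  shows "odd_square_zero_module (A \<inter> odd_space)" "A = with_even (A \<inter> odd_space)"
proof -
  note A = commutative_subalgebraD[OF A]
  have "x * y = 0" if "x \<in> A \<inter> odd_space" "y \<in> A \<inter> odd_space" for x y
  proof (rule eq_uminus_imp_zero)
    have "y * x = x * y"
      using A(4) that by blast
    then show "x * y = - (x * y)"
      using odd_anticommute[of x y] that by simp
  qed
  moreover have "grassmann.subspace (A \<inter> odd_space)"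
    by (rule grassmann.subspace_inter[OF A(1) subspace_monom_space])
  moreover have "e * d \<in> A \<inter> odd_space" if "e \<in> even_space" "d \<in> A \<inter> odd_space" for e d
    using that even A(3) even_mult_odd by blast
  ultimately show "odd_square_zero_module (A \<inter> odd_space)"
    unfolding odd_square_zero_module_def square_zero_subspace_def by blast
  show "A = with_even (A \<inter> odd_space)"
  proof (intro equalityI subsetI)
    fix x assume x: "x \<in> A"
    obtain e d where ed: "e \<in> even_space" "d \<in> odd_space" "x = e + d"
      by (rule even_odd_decomp)
    have "x - e \<in> A"
      using x ed even by (intro grassmann.subspace_diff[OF A(1)]) auto
    then show "x \<in> with_even (A \<inter> odd_space)"
      using ed by auto
  next
    fix x assume "x \<in> with_even (A \<inter> odd_space)"
    then show "x \<in> A"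
      using even by (auto intro: grassmann.subspace_add[OF A(1)])
  qed
qed

text \<open>
  The span of the products \<open>e a\<close> is closed under multiplication because \<open>e\<close> is central.
\<close>

lemma adjoin_even_space:
  assumes "commutative_subalgebra (A :: ('a, 'n) grassmann set)"
  obtains B where "commutative_subalgebra B" "A \<subseteq> B" "even_space \<subseteq> B"
proof -
  note A = commutative_subalgebraD[OF assms]
  let ?G = "{e * a | e a. e \<in> even_space \<and> a \<in> A}"
  let ?B = "grassmann.span ?G"
  have gen: "g * h \<in> ?G \<and> g * h = h * g" if gh: "g \<in> ?G" "h \<in> ?G" for g h
  proof -
    obtain e a where g: "g = e * a" "e \<in> even_space" "a \<in> A"
      using gh by blast
    obtain e' a' where h: "h = e' * a'" "e' \<in> even_space" "a' \<in> A"
      using gh by blast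
    have "g * h = (e * e') * (a * a')"
      using even_commute[OF h(2), of a] g(1) h(1) by (metis mult.assoc)
    moreover have "h * g = (e' * e) * (a' * a)"
      using even_commute[OF g(2), of a'] g(1) h(1) by (metis mult.assoc)
    moreover have "e * e' \<in> even_space" "a * a' \<in> A"
      using g h A(3) even_mult_even by auto
    ultimately show ?thesis
      using even_commute[OF g(2), of e'] A(4)[OF g(3) h(3)] by auto
  qed
  have left: "g * y \<in> ?B \<and> g * y = y * g" if "g \<in> ?G" "y \<in> ?B" for g y
    using that(2)
  proof (induction rule: grassmann.span_induct_alt)
    case base
    then show ?case by (simp add: grassmann.span_zero)
  next
    case (step c x y)
    have x: "g * x \<in> ?B"
      by (rule grassmann.span_base) (rule conjunct1[OF gen[OF that(1) step(1)]])
    have x': "x * g = g * x"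
      using gen[OF that(1) step(1)] by (rule conjE) (rule sym)
    have y: "g * y \<in> ?B" "y * g = g * y"
      using step.IH by auto
    have "g * (c *\<^sub>g x + y) = c *\<^sub>g (g * x) + g * y"
      by (simp add: algebra_simps grassmann_scale_mult_right)
    moreover have "(c *\<^sub>g x + y) * g = c *\<^sub>g (g * x) + g * y"
      by (simp only: distrib_right grassmann_scale_mult_left x' y(2))
    moreover have "c *\<^sub>g (g * x) + g * y \<in> ?B"
      by (intro grassmann.span_add grassmann.span_scale x y)
    ultimately show ?case
      by (simp only: simp_thms)
  qed
  have closed: "x * y \<in> ?B \<and> x * y = y * x" if "x \<in> ?B" "y \<in> ?B" for x y
    using that(1)
  proof (induction rule: grassmann.span_induct_alt)
    case base
    then show ?case by (simp add: grassmann.span_zero)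
  next
    case (step c g x)
    have g: "g * y \<in> ?B" "y * g = g * y"
      using left[OF step(1) that(2)] by auto
    have x: "x * y \<in> ?B" "y * x = x * y"
      using step.IH by auto
    have "(c *\<^sub>g g + x) * y = c *\<^sub>g (g * y) + x * y"
      by (simp add: algebra_simps grassmann_scale_mult_left)
    moreover have "y * (c *\<^sub>g g + x) = c *\<^sub>g (g * y) + x * y"
      by (simp only: distrib_left grassmann_scale_mult_right g(2) x(2))
    moreover have "c *\<^sub>g (g * y) + x * y \<in> ?B"
      by (intro grassmann.span_add grassmann.span_scale g x)
    ultimately show ?case
      by (simp only: simp_thms)
  qed
  have "1 \<in> even_space"
    by (simp add: one_in_monom_space)
  have "A \<subseteq> ?G"
  proof
    fix a assume "a \<in> A"
    then show "a \<in> ?G"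
      using \<open>1 \<in> even_space\<close> by (intro CollectI exI[of _ 1] exI[of _ a]) simp
  qed
  then have "A \<subseteq> ?B"
    using grassmann.span_superset by (rule subset_trans)
  have "even_space \<subseteq> ?G"
  proof
    fix e assume "e \<in> even_space"
    then show "e \<in> ?G"
      using A(2) by (intro CollectI exI[of _ e] exI[of _ 1]) simp
  qed
  then have "even_space \<subseteq> ?B"
    using grassmann.span_superset by (rule subset_trans)
  moreover have "commutative_subalgebra ?B"
    unfolding commutative_subalgebra_def subalgebra_def
    using closed \<open>A \<subseteq> ?B\<close> A(2) grassmann.subspace_span by blast
  ultimately show thesis
    using that \<open>A \<subseteq> ?B\<close> by blast
qed

lemma dim_commutative_le:
  assumes "commutative_subalgebra (A :: ('a, 'n) grassmann set)"
  shows "grassmann.dim A \<le> 2 ^ (CARD('n) - 1) + max_system_size CARD('n)"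
proof -
  obtain B :: "('a, 'n) grassmann set"
    where B: "commutative_subalgebra B" "A \<subseteq> B" "even_space \<subseteq> B"
    by (rule adjoin_even_space[OF assms])
  note D = odd_square_zero_moduleD[OF odd_part_of_commutative(1)[OF B(1,3)]]
  obtain F :: "'n set set" where F: "odd_intersecting_system F" "grassmann.dim (B \<inter> odd_space) \<le> card F"
    using square_zero_initial_system[OF D(1-3)] by metis
  have "grassmann.dim A \<le> grassmann.dim B"
    by (rule fin.dim_subset[OF B(2)])
  also have "\<dots> = 2 ^ (CARD('n) - 1) + grassmann.dim (B \<inter> odd_space)"
    by (subst odd_part_of_commutative(2)[OF B(1,3)]) (rule dim_with_even[OF D(1,2)])
  finally show ?thesis
    using F(2) card_odd_intersecting_le(1)[OF F(1)] by simp
qed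

lemma odd_square_zero_module_monom_space:
  assumes F: "odd_intersecting_system F" "odd_upclosed F"
  shows "odd_square_zero_module (monom_space F)"
  unfolding odd_square_zero_module_def square_zero_subspace_def
proof (intro conjI ballI subspace_monom_space)
  show "c * d = 0" if "c \<in> monom_space F" "d \<in> monom_space F" for c d :: "('a, 'n) grassmann"
    using that by (rule mult_eq_zero_if_meet) (use F in \<open>auto simp: odd_intersecting_system_def\<close>)
  show "monom_space F \<subseteq> odd_space"
    by (rule monom_space_mono) (use F in \<open>auto simp: odd_intersecting_system_def\<close>)
  show "e * d \<in> monom_space F" if "e \<in> even_space" "d \<in> monom_space F" for e d
    using that
  proof (rule mult_in_monom_space)
    fix J K :: "'n set"
    assume JK: "J \<in> {J. even (card J)}" "K \<in> F" "J \<inter> K = {}"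
    then have "odd (card (J \<union> K))"
      using F by (simp add: card_Un_disjoint odd_intersecting_system_def)
    then show "J \<union> K \<in> F"
      using F JK by (auto simp: odd_upclosed_def)
  qed
qed

lemma max_commutative_exists:
  "\<exists>A :: ('a, 'n) grassmann set. commutative_subalgebra A \<and>
    grassmann.dim A = 2 ^ (CARD('n) - 1) + max_system_size CARD('n)"
proof -
  obtain F :: "'n set set" where F: "odd_intersecting_system F" "odd_upclosed F" "card F = max_system_size CARD('n)"
    using odd_intersecting_max_exists by blast
  note D = odd_square_zero_module_monom_space[OF F(1,2)]
  show ?thesis
    using commutative_subalgebra_with_even[OF D] dim_with_even[OF odd_square_zero_moduleD(1,2)[OF D]] F(3)
    by (intro exI[of _ "with_even (monom_space F)"]) (simp add: dim_monom_space)
qed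

text \<open>
  The odd part of a commutative subalgebra yields an odd intersecting system by initial sets, and
  the monomials of a largest system attain the bound.
\<close>

lemma is_arg_max_commutative_iff:
  "is_arg_max grassmann.dim commutative_subalgebra A \<longleftrightarrow>
    commutative_subalgebra A \<and> grassmann.dim A = 2 ^ (CARD('n) - 1) + max_system_size CARD('n)"
  for A :: "('a, 'n) grassmann set"
proof -
  obtain M :: "('a, 'n) grassmann set" where M: "commutative_subalgebra M"
    "grassmann.dim M = 2 ^ (CARD('n) - 1) + max_system_size CARD('n)"
    using max_commutative_exists by blast
  show ?thesis
  proof
    assume A: "is_arg_max grassmann.dim commutative_subalgebra A"
    then have "commutative_subalgebra A" "\<not> grassmann.dim A < grassmann.dim M"
      using M(1) by (auto simp: is_arg_max_def)
    then show "commutative_subalgebra A \<and> grassmann.dim A = 2 ^ (CARD('n) - 1) + max_system_size CARD('n)"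
      using dim_commutative_le[of A] M(2) by simp
  next
    assume "commutative_subalgebra A \<and> grassmann.dim A = 2 ^ (CARD('n) - 1) + max_system_size CARD('n)"
    then show "is_arg_max grassmann.dim commutative_subalgebra A"
      unfolding is_arg_max_def using dim_commutative_le by (simp add: not_less)
  qed
qed

lemma odd_square_zero_module_sum:
  assumes D: "odd_square_zero_module D" and U: "odd_square_zero_module U"
    and zero: "\<And>d u. d \<in> D \<Longrightarrow> u \<in> U \<Longrightarrow> d * u = 0"
  shows "odd_square_zero_module {d + u | d u. d \<in> D \<and> u \<in> U}"
proof -
  note D = odd_square_zero_moduleD[OF D] and U = odd_square_zero_moduleD[OF U]
  have zero': "u * d = 0" if "d \<in> D" "u \<in> U" for d u
    using odd_anticommute[of u d] zero[OF that] D(2) U(2) that by auto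
  have "grassmann.subspace {d + u | d u. d \<in> D \<and> u \<in> U}"
    by (rule grassmann.subspace_sums[OF D(1) U(1)])
  moreover have "d + u \<in> odd_space" if "d \<in> D" "u \<in> U" for d u
    using that D(2) U(2) by (intro grassmann.subspace_add[OF subspace_monom_space]) auto
  moreover have "(d + u) * (d' + u') = 0" if "d \<in> D" "u \<in> U" "d' \<in> D" "u' \<in> U" for d u d' u'
    using that by (simp add: distrib_left distrib_right D(3) U(3) zero zero')
  moreover have "e * (d + u) \<in> {d + u | d u. d \<in> D \<and> u \<in> U}"
    if "e \<in> even_space" "d \<in> D" "u \<in> U" for e d u
    using D(4)[OF that(1,2)] U(4)[OF that(1,3)] by (auto simp: distrib_left)
  ultimately show ?thesis
    unfolding odd_square_zero_module_def square_zero_subspace_def by blast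
qed

lemma maximal_contains_even:
  assumes "maximal_commutative_subalgebra (A :: ('a, 'n) grassmann set)"
  shows "commutative_subalgebra A" "even_space \<subseteq> A"
proof -
  show A: "commutative_subalgebra A"
    using assms by (simp add: maximal_commutative_subalgebra_def)
  obtain B :: "('a, 'n) grassmann set"
    where "commutative_subalgebra B" "A \<subseteq> B" "even_space \<subseteq> B"
    by (rule adjoin_even_space[OF A])
  then show "even_space \<subseteq> A"
    using assms by (auto simp: maximal_commutative_subalgebra_def)
qed

text \<open>
  The main tool for using maximality: if \<open>U\<close> annihilates the odd part of \<open>A\<close>, then \<open>A + U\<close> is again
  a commutative subalgebra.
\<close>

lemma maximal_absorbs:
  assumes A: "maximal_commutative_subalgebra A" and U: "odd_square_zero_module U"
    and zero: "\<And>d u. d \<in> A \<inter> odd_space \<Longrightarrow> u \<in> U \<Longrightarrow> d * u = 0"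
  shows "U \<subseteq> A"
proof -
  let ?D = "A \<inter> odd_space"
  note A' = maximal_contains_even[OF A]
  note D = odd_part_of_commutative[OF A']
  let ?S = "{d + u | d u. d \<in> ?D \<and> u \<in> U}"
  have S: "odd_square_zero_module ?S"
    by (rule odd_square_zero_module_sum[OF D(1) U zero])
  have "0 \<in> U" "0 \<in> ?D" "(0 :: ('a, 'n) grassmann) \<in> even_space"
    using odd_square_zero_moduleD(1)[OF U] odd_square_zero_moduleD(1)[OF D(1)]
      subspace_monom_space grassmann.subspace_0 by blast+
  have "?D \<subseteq> ?S"
  proof
    fix d assume "d \<in> ?D"
    then show "d \<in> ?S"
      using \<open>0 \<in> U\<close> by (intro CollectI exI[of _ d] exI[of _ 0]) simp
  qed
  then have "A \<subseteq> with_even ?S"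
    by (subst D(2)) blast
  moreover have "commutative_subalgebra (with_even ?S)"
    by (rule commutative_subalgebra_with_even[OF S])
  moreover have "\<not> (\<exists>B. commutative_subalgebra B \<and> A \<subset> B)"
    using A unfolding maximal_commutative_subalgebra_def by (rule conjunct2)
  ultimately have eq: "with_even ?S = A"
    by blast
  show ?thesis
  proof
    fix u assume "u \<in> U"
    then have "u \<in> ?S"
      using \<open>0 \<in> ?D\<close> by (intro CollectI exI[of _ 0] exI[of _ u]) simp
    then have "u \<in> with_even ?S"
      using \<open>0 \<in> even_space\<close> by (intro CollectI exI[of _ 0] exI[of _ u]) simp
    then show "u \<in> A"
      by (simp only: eq)
  qed
qed

lemma max_dim_imp_maximal:
  assumes A: "commutative_subalgebra (A :: ('a, 'n) grassmann set)"
    and dim: "grassmann.dim A = 2 ^ (CARD('n) - 1) + max_system_size CARD('n)"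
  shows "maximal_commutative_subalgebra A"
  unfolding maximal_commutative_subalgebra_def
proof (intro conjI A notI)
  assume "\<exists>B. commutative_subalgebra B \<and> A \<subset> B"
  then obtain B where B: "commutative_subalgebra B" "A \<subset> B" by blast
  have "grassmann.dim B \<le> grassmann.dim A"
    using dim_commutative_le[OF B(1)] dim by simp
  then have "A = B"
    using fin.subspace_dim_equal[OF commutative_subalgebraD(1)[OF A] commutative_subalgebraD(1)[OF B(1)]] B(2)
    by blast
  then show False using B(2) by blast
qed

section \<open>Maximal subalgebras for an even number of generators\<close>

lemma dim_kernel_ge:
  assumes V: "grassmann.subspace (V :: ('a, 'n) grassmann set)"
    and lin: "\<And>x y. \<phi> (x + y) = \<phi> x + \<phi> y" "\<And>c x. \<phi> (c *\<^sub>g x) = c * \<phi> x"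
  shows "grassmann.dim V \<le> grassmann.dim {x \<in> V. \<phi> x = (0::'a)} + 1"
proof (cases "\<exists>v\<in>V. \<phi> v \<noteq> 0")
  case True
  then obtain v where v: "v \<in> V" "\<phi> v \<noteq> 0" by blast
  let ?K = "{x \<in> V. \<phi> x = 0}"
  have "V \<subseteq> grassmann.span (insert v ?K)"
  proof
    fix x assume "x \<in> V"
    \<comment> \<open>Subtract the multiple of \<open>v\<close> that makes \<open>\<phi>\<close> vanish.\<close>
    define y where "y = x + (- (\<phi> x / \<phi> v)) *\<^sub>g v"
    have "\<phi> y = 0"
      unfolding y_def lin using v by simp
    moreover have "y \<in> V"
      unfolding y_def using V \<open>x \<in> V\<close> v by (intro grassmann.subspace_add grassmann.subspace_scale)
    ultimately have "y \<in> grassmann.span (insert v ?K)"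
      by (intro grassmann.span_base) simp
    moreover have "x = y + (\<phi> x / \<phi> v) *\<^sub>g v"
      by (simp add: y_def)
    moreover have "(\<phi> x / \<phi> v) *\<^sub>g v \<in> grassmann.span (insert v ?K)"
      by (intro grassmann.span_scale grassmann.span_base) simp
    ultimately show "x \<in> grassmann.span (insert v ?K)"
      using grassmann.span_add by metis
  qed
  then have "grassmann.dim V \<le> grassmann.dim (insert v ?K)"
    by (rule fin.dim_mono)
  also have "\<dots> \<le> grassmann.dim ?K + 1"
    by (simp add: fin.dim_insert)
  finally show ?thesis .
next
  case False
  then have "{x \<in> V. \<phi> x = 0} = V" by auto
  then show ?thesis by simp
qed

text \<open>
  Each \<open>b\<close> in \<open>B\<close> imposes one linear condition on \<open>x\<close>.
\<close>

lemma dim_perp_ge: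
  assumes "finite B"
  shows "grassmann.dim odd_space \<le>
    grassmann.dim {x \<in> odd_space. \<forall>b\<in>B. gcoeff (b * x) UNIV = 0} + card B"
  using assms
proof (induction B)
  case empty
  then show ?case by simp
next
  case (insert b B)
  let ?V = "{x \<in> odd_space. \<forall>b\<in>B. gcoeff (b * x) UNIV = 0}"
  have "grassmann.subspace ?V"
    unfolding grassmann.subspace_def
  proof (intro conjI ballI allI)
    show "0 \<in> ?V"
      using grassmann.subspace_0[OF subspace_monom_space] by simp
    show "x + y \<in> ?V" if "x \<in> ?V" "y \<in> ?V" for x y
      using that grassmann.subspace_add[OF subspace_monom_space, of x _ y] by (simp add: distrib_left)
    show "c *\<^sub>g x \<in> ?V" if "x \<in> ?V" for c x
      using that grassmann.subspace_scale[OF subspace_monom_space, of x] by (simp add: grassmann_scale_mult_right)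
  qed
  then have "grassmann.dim ?V \<le> grassmann.dim {x \<in> ?V. gcoeff (b * x) UNIV = 0} + 1"
    by (rule dim_kernel_ge) (simp_all add: distrib_left grassmann_scale_mult_right)
  also have "{x \<in> ?V. gcoeff (b * x) UNIV = 0} = {x \<in> odd_space. \<forall>b\<in>insert b B. gcoeff (b * x) UNIV = 0}"
    by auto
  finally show ?case
    using insert by simp
qed

text \<open>
  If \<open>d x\<close> had a nonzero coefficient at an even set \<open>S\<close>, multiplying by the monomial of the
  complement of \<open>S\<close>, which is even because \<open>n\<close> is, would produce an element of \<open>D\<close> whose product
  with \<open>x\<close> has a nonzero top coefficient. So \<open>x\<close> annihilates \<open>D\<close>. Moreover \<open>x\<^sup>2 = 0\<close>, so the even
  multiples of \<open>x\<close> can be added to \<open>A\<close>.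
\<close>

lemma maximal_self_perp:
  assumes A: "maximal_commutative_subalgebra A" and n: "even CARD('n)"
    and x: "x \<in> odd_space" "\<And>d. d \<in> A \<inter> odd_space \<Longrightarrow> gcoeff (d * x) UNIV = 0"
  shows "x \<in> A"
proof -
  let ?D = "A \<inter> odd_space"
  note A' = maximal_contains_even[OF A]
  note D = odd_square_zero_moduleD[OF odd_part_of_commutative(1)[OF A']]
  have dx: "d * x = 0" if "d \<in> ?D" for d
  proof (rule grassmann_eqI)
    fix S
    have "d * x \<in> even_space"
      using that x(1) odd_mult_odd by blast
    show "gcoeff (d * x) S = gcoeff 0 S"
    proof (cases "even (card S)")
      case True
      then have "even (card (- S))"
        using n card_le_CARD[of S] by (simp add: card_Compl_UNIV)
      then have "grassmann_monom (- S) * d \<in> ?D"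
        by (intro D(4) that) (simp add: monom_in_monom_space)
      from x(2)[OF this] have "gcoeff (grassmann_monom (- S) * (d * x)) UNIV = 0"
        by (simp add: mult.assoc)
      moreover have "UNIV - - S = S"
        by auto
      ultimately show ?thesis
        using wedge_coeff_nonzero[of "- S" S] by (simp add: gcoeff_monom_mult)
    next
      case False
      then show ?thesis
        using monom_spaceD[OF \<open>d * x \<in> even_space\<close>] by simp
    qed
  qed
  \<comment> \<open>The even multiples of \<open>x\<close> are absorbed by \<open>A\<close>.\<close>
  define U where "U = (\<lambda>e. e * x) ` even_space"
  have "odd_square_zero_module U"
    unfolding odd_square_zero_module_def square_zero_subspace_def
  proof (intro conjI ballI)
    show "grassmann.subspace U"
      unfolding grassmann.subspace_def
    proof (intro conjI ballI allI)
      show "0 \<in> U"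
        unfolding U_def using grassmann.subspace_0[OF subspace_monom_space] by (intro image_eqI[of _ _ 0]) auto
      show "y + z \<in> U" if yz: "y \<in> U" "z \<in> U" for y z
      proof -
        obtain e e' where "y = e * x" "z = e' * x" "e \<in> even_space" "e' \<in> even_space"
          using yz by (auto simp: U_def)
        then show ?thesis
          unfolding U_def using grassmann.subspace_add[OF subspace_monom_space, of e _ e']
          by (intro image_eqI[of _ _ "e + e'"]) (simp_all add: distrib_right)
      qed
      show "c *\<^sub>g y \<in> U" if y: "y \<in> U" for c y
      proof -
        obtain e where "y = e * x" "e \<in> even_space"
          using y by (auto simp: U_def)
        then show ?thesis
          unfolding U_def using grassmann.subspace_scale[OF subspace_monom_space, of e]
          by (intro image_eqI[of _ _ "c *\<^sub>g e"]) (simp_all add: grassmann_scale_mult_left)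
      qed
    qed
    show "U \<subseteq> odd_space"
      using x(1) even_mult_odd by (auto simp: U_def)
    show "y * z = 0" if yz: "y \<in> U" "z \<in> U" for y z
    proof -
      obtain e e' where e: "y = e * x" "z = e' * x" "e \<in> even_space" "e' \<in> even_space"
        using yz by (auto simp: U_def)
      have "y * z = e * ((x * e') * x)"
        by (simp only: e(1,2) mult.assoc)
      also have "\<dots> = e * (e' * (x * x))"
        by (simp only: even_commute[OF e(4), of x, symmetric] mult.assoc)
      finally show ?thesis
        by (simp add: odd_square[OF x(1)])
    qed
    show "e * y \<in> U" if ey: "e \<in> even_space" "y \<in> U" for e y
    proof -
      obtain e' where "y = e' * x" "e' \<in> even_space"
        using ey by (auto simp: U_def)
      then show ?thesis
        unfolding U_def using ey(1) even_mult_even by (intro image_eqI[of _ _ "e * e'"]) (simp_all add: mult.assoc)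
    qed
  qed
  moreover have "d * u = 0" if du: "d \<in> ?D" "u \<in> U" for d u
  proof -
    obtain e where e: "u = e * x" "e \<in> even_space"
      using du by (auto simp: U_def)
    have "d * u = (d * e) * x"
      by (simp only: e(1) mult.assoc)
    also have "\<dots> = e * (d * x)"
      by (simp only: even_commute[OF e(2), of d, symmetric] mult.assoc)
    finally show ?thesis
      using dx[OF du(1)] by simp
  qed
  ultimately have "U \<subseteq> A"
    by (rule maximal_absorbs[OF A])
  moreover have "x \<in> U"
    unfolding U_def by (rule image_eqI[of _ _ 1]) (simp_all add: one_in_monom_space)
  ultimately show ?thesis by blast
qed

lemma even_CARD_ge_2: "even CARD('n) \<Longrightarrow> 2 \<le> CARD('n)"
proof -
  assume "even CARD('n)"
  then have "CARD('n) \<noteq> 0" "CARD('n) \<noteq> 1"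
    by auto
  then show ?thesis by linarith
qed

lemma max_dim_even:
  assumes "even CARD('n)"
  shows "2 ^ (CARD('n) - 1) + max_system_size CARD('n) = 3 * 2 ^ (CARD('n) - 2)"
proof -
  obtain m where "CARD('n) = m + 2"
    using even_CARD_ge_2[OF assms] by (metis add.commute le_Suc_ex)
  then show ?thesis
    using assms by (simp add: max_system_size_def)
qed

text \<open>
  The odd part of \<open>A\<close> contains its orthogonal complement in the space of odd elements, so it has at
  least half the dimension of that space. The general upper bound says that it has at most half.
\<close>

lemma dim_maximal_even:
  assumes A: "maximal_commutative_subalgebra (A :: ('a, 'n) grassmann set)" and n: "even CARD('n)"
  shows "grassmann.dim A = 3 * 2 ^ (CARD('n) - 2)"
proof -
  let ?D = "A \<inter> odd_space"
  note A' = maximal_contains_even[OF A]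
  note D = odd_part_of_commutative[OF A']
  note D' = odd_square_zero_moduleD[OF D(1)]
  obtain B where B: "B \<subseteq> ?D" "grassmann.independent B" "?D \<subseteq> grassmann.span B" "card B = grassmann.dim ?D"
    by (rule grassmann.basis_exists)
  have "finite B"
    using B(2) by (rule fin.finiteI_independent)
  have "{x \<in> odd_space. \<forall>b\<in>B. gcoeff (b * x) UNIV = 0} \<subseteq> ?D"
  proof
    fix x assume x: "x \<in> {x \<in> odd_space. \<forall>b\<in>B. gcoeff (b * x) UNIV = 0}"
    have "gcoeff (d * x) UNIV = 0" if "d \<in> grassmann.span B" for d
      using that
    proof (induction rule: grassmann.span_induct_alt)
      case (step c b y)
      then show ?case
        using x by (simp add: distrib_right grassmann_scale_mult_left)
    qed simp
    then have "x \<in> A"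
      using x B(3) by (intro maximal_self_perp[OF A n]) blast+
    then show "x \<in> ?D"
      using x by blast
  qed
  then have "grassmann.dim {x \<in> odd_space. \<forall>b\<in>B. gcoeff (b * x) UNIV = 0} \<le> grassmann.dim ?D"
    by (rule fin.dim_subset)
  then have "2 ^ (CARD('n) - 1) \<le> 2 * grassmann.dim ?D"
    using dim_perp_ge[OF \<open>finite B\<close>] B(4) by (simp add: dim_odd_space)
  moreover have "grassmann.dim A = 2 ^ (CARD('n) - 1) + grassmann.dim ?D"
    by (subst D(2)) (rule dim_with_even[OF D'(1,2)])
  moreover have "grassmann.dim A \<le> 3 * 2 ^ (CARD('n) - 2)"
    using dim_commutative_le[OF A'(1)] max_dim_even[OF n] by simp
  moreover obtain m where "CARD('n) = m + 2"
    using even_CARD_ge_2[OF n] by (metis add.commute le_Suc_ex)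
  ultimately show ?thesis
    by simp
qed

section \<open>The algebras of stars\<close>

lemma with_even_monom_space:
  "with_even (monom_space F) = monom_space ({J. even (card J)} \<union> F)"
proof (intro equalityI subsetI)
  fix x assume "x \<in> with_even (monom_space F)"
  then show "x \<in> monom_space ({J. even (card J)} \<union> F)"
    using grassmann.subspace_add[OF subspace_monom_space]
      monom_space_mono[of "{J. even (card J)}" "{J. even (card J)} \<union> F"]
      monom_space_mono[of F "{J. even (card J)} \<union> F"] by blast
next
  fix x :: "('a, 'n) grassmann"
  assume x: "x \<in> monom_space ({J. even (card J)} \<union> F)"
  have "monom_part (- {J. even (card J)}) x \<in> monom_space F"
    using x by (auto simp: monom_space_def gcoeff_monom_part)
  moreover have "x = monom_part {J. even (card J)} x + monom_part (- {J. even (card J)}) x"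
    by (rule sym, rule monom_part_add) auto
  ultimately show "x \<in> with_even (monom_space F)"
    using monom_part_in[of "{J. even (card J)}" x] by blast
qed

lemma monom_system_algebra:
  assumes "odd_intersecting_system F" "odd_upclosed F"
  shows "commutative_subalgebra (monom_space ({J. even (card J)} \<union> F) :: ('a, 'n) grassmann set)"
    and "grassmann.dim (monom_space ({J. even (card J)} \<union> F) :: ('a, 'n) grassmann set) =
      2 ^ (CARD('n) - 1) + card F"
proof -
  have D: "odd_square_zero_module (monom_space F)"
    by (rule odd_square_zero_module_monom_space[OF assms])
  show "commutative_subalgebra (monom_space ({J. even (card J)} \<union> F) :: ('a, 'n) grassmann set)"
    using commutative_subalgebra_with_even[OF D] by (simp only: with_even_monom_space)
  show "grassmann.dim (monom_space ({J. even (card J)} \<union> F) :: ('a, 'n) grassmann set) =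
      2 ^ (CARD('n) - 1) + card F"
    using dim_with_even[OF odd_square_zero_moduleD(1,2)[OF D]] by (simp only: with_even_monom_space dim_monom_space)
qed

text \<open>
  An odd element of a larger commutative subalgebra annihilates \<open>v\<^sub>a\<close>, and so only sets
  through \<open>a\<close> occur in it.
\<close>

lemma star_algebra_maximal:
  "maximal_commutative_subalgebra (monom_space ({J. even (card J)} \<union> odd_star a) :: ('a, 'n) grassmann set)"
    (is "maximal_commutative_subalgebra ?A")
  unfolding maximal_commutative_subalgebra_def
proof (intro conjI notI)
  show "commutative_subalgebra ?A"
    by (rule monom_system_algebra(1)[OF odd_intersecting_odd_star odd_upclosed_odd_star])
  assume "\<exists>B. commutative_subalgebra B \<and> ?A \<subset> B"
  then obtain B where B: "commutative_subalgebra B" "?A \<subset> B" by blast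
  have even: "even_space \<subseteq> B"
    using B(2) monom_space_mono[of "{J. even (card J)}" "{J. even (card J)} \<union> odd_star a"] by blast
  note D = odd_part_of_commutative[OF B(1) even]
  have a: "grassmann_monom {a} \<in> B \<inter> odd_space"
  proof -
    have "grassmann_monom {a} \<in> ?A"
      by (simp add: monom_in_monom_space odd_star_def)
    moreover have "grassmann_monom {a} \<in> odd_space"
      by (simp add: monom_in_monom_space)
    ultimately show ?thesis
      using B(2) by blast
  qed
  have "B \<inter> odd_space \<subseteq> monom_space (odd_star a)"
  proof
    fix d assume d: "d \<in> B \<inter> odd_space"
    have zero: "grassmann_monom {a} * d = 0"
      by (rule odd_square_zero_moduleD(3)[OF D(1) a d])
    show "d \<in> monom_space (odd_star a)"
      unfolding monom_space_def
    proof (intro CollectI allI impI)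
      fix J assume J: "gcoeff d J \<noteq> 0"
      then have "odd (card J)"
        using d by (auto simp: monom_space_def)
      moreover have "a \<in> J"
      proof (rule ccontr)
        assume "a \<notin> J"
        then have "gcoeff (grassmann_monom {a} * d) (insert a J) = gcoeff d J * wedge_coeff {a} J"
          by (simp add: gcoeff_monom_mult)
        then show False
          using zero J wedge_coeff_nonzero[of "{a}" J] \<open>a \<notin> J\<close> by simp
      qed
      ultimately show "J \<in> odd_star a"
        by (simp add: odd_star_def)
    qed
  qed
  then have "with_even (B \<inter> odd_space) \<subseteq> with_even (monom_space (odd_star a))"
    by blast
  then have "B \<subseteq> ?A"
    using D(2) by (simp only: with_even_monom_space)
  then show False
    using B(2) by blast
qed

lemma star_algebra_not_max:
  assumes "odd CARD('n)" "CARD('n) \<ge> 5"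
  shows "\<not> is_arg_max grassmann.dim commutative_subalgebra
    (monom_space ({J. even (card J)} \<union> odd_star a) :: ('a, 'n) grassmann set)"
proof -
  have "card (odd_star a) < max_system_size CARD('n)"
    by (rule card_odd_intersecting_le(2)[OF odd_intersecting_odd_star assms(1), of "{a}"])
      (use assms(2) in \<open>simp_all add: odd_star_def\<close>)
  then show ?thesis
    by (simp add: is_arg_max_commutative_iff monom_system_algebra(2)[OF odd_intersecting_odd_star odd_upclosed_odd_star])
qed

lemma augmentation_mult: "gcoeff (x * y) {} = gcoeff x {} * gcoeff y {}" for x y :: "('a, 'n) grassmann"
  by (simp add: gcoeff_mult wedge_coeff_def gcoeff_one)

lemma monom_part_linear:
  "monom_part F (x + y) = monom_part F x + monom_part F y"
  "monom_part F (c *\<^sub>g x) = c *\<^sub>g monom_part F x"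
  by (rule grassmann_eqI, simp add: gcoeff_monom_part)+

lemma monom_part_id: "x \<in> monom_space F \<Longrightarrow> monom_part F x = x"
  by (rule grassmann_eqI) (auto simp: gcoeff_monom_part monom_space_def)

text \<open>
  An isomorphism \<open>f\<close> respects constant coefficients: a nonempty monomial has square zero, so the
  constant coefficient of its image, a scalar, has square zero. Hence \<open>f\<close> maps products of two elements without
  constant coefficient to such products. In the algebra of the star these span the monomials of
  even sets of size at least 4 and of odd sets through \<open>a\<close> of size at least 3. In the algebra of the
  flipped star, where \<open>v\<^sub>a\<close> is missing, only odd sets through \<open>a\<close> of size at least 5 are reached, and the
  complement of \<open>{a}\<close> is not reached either. So \<open>f\<close> would embed a space into a smaller one.
\<close>

lemma star_algebras_not_isomorphic:
  assumes n: "even CARD('n)" "CARD('n) > 2"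
  shows "\<not> isomorphic_subalgebras
    (monom_space ({J. even (card J)} \<union> odd_star a) :: ('a, 'n) grassmann set)
    (monom_space ({J. even (card J)} \<union> flipped_star a))"
proof
  let ?I = "{J. even (card J)} \<union> odd_star a" and ?I' = "{J. even (card J)} \<union> flipped_star a"
  let ?A = "monom_space ?I :: ('a, 'n) grassmann set" and ?B = "monom_space ?I' :: ('a, 'n) grassmann set"
  let ?P = "{J. even (card J) \<and> 4 \<le> card J \<or> J \<in> odd_star a \<and> 3 \<le> card J}"
  let ?P' = "{J. even (card J) \<and> 4 \<le> card J \<or> J \<in> odd_star a \<and> 5 \<le> card J}"
  assume "isomorphic_subalgebras ?A ?B"
  then obtain f where f: "bij_betw f ?A ?B"
    and f_add: "\<And>x y. x \<in> ?A \<Longrightarrow> y \<in> ?A \<Longrightarrow> f (x + y) = f x + f y"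
    and f_mult: "\<And>x y. x \<in> ?A \<Longrightarrow> y \<in> ?A \<Longrightarrow> f (x * y) = f x * f y"
    and f_scale: "\<And>c x. x \<in> ?A \<Longrightarrow> f (c *\<^sub>g x) = c *\<^sub>g f x"
    unfolding isomorphic_subalgebras_def by blast
  have "0 \<in> ?A"
    by (rule grassmann.subspace_0[OF subspace_monom_space])
  have f_zero: "f 0 = 0"
    using f_scale[OF \<open>0 \<in> ?A\<close>, of 0] by simp
  have gen: "f (grassmann_monom J) \<in> monom_space (?I' - {{}})" if J: "J \<in> ?I" "J \<noteq> {}" for J
  proof -
    have m: "grassmann_monom J \<in> ?A"
      using J(1) by (simp only: monom_in_monom_space)
    have "f (grassmann_monom J) * f (grassmann_monom J) = f (grassmann_monom J * grassmann_monom J)"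
      by (rule f_mult[OF m m, symmetric])
    also have "grassmann_monom J * grassmann_monom J = (0 :: ('a, 'n) grassmann)"
      using J(2) by (simp add: monom_mult)
    finally have "gcoeff (f (grassmann_monom J)) {} = 0"
      using augmentation_mult[of "f (grassmann_monom J)" "f (grassmann_monom J)"] f_zero by simp
    moreover have "f (grassmann_monom J) \<in> ?B"
      using f m by (rule bij_betw_apply)
    ultimately have supp: "S \<in> ?I' - {{}}" if "gcoeff (f (grassmann_monom J)) S \<noteq> 0" for S
      using that monom_spaceD[of "f (grassmann_monom J)" ?I' S] by (cases "S = {}") auto
    show ?thesis
      unfolding monom_space_def by (intro CollectI allI impI) (rule supp)
  qed
  have prod: "f (grassmann_monom J) \<in> monom_space ?P'" if J: "J \<in> ?P" for J
  proof -
    obtain K L where KL: "J = K \<union> L" "K \<inter> L = {}" "K \<noteq> {}" "L \<noteq> {}" "K \<in> ?I" "L \<in> ?I"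
    proof -
      from J have "even (card J) \<and> 4 \<le> card J \<or> J \<in> odd_star a \<and> 3 \<le> card J" by blast
      then obtain K L where "J = K \<union> L" "K \<inter> L = {}" "K \<noteq> {}" "L \<noteq> {}"
        "even (card K) \<or> K \<in> odd_star a" "even (card L)"
        by (rule even_star_split)
      then show thesis
        by (intro that[of K L]) simp_all
    qed
    have m: "grassmann_monom K \<in> ?A" "grassmann_monom L \<in> ?A"
      using KL(5,6) by (simp_all only: monom_in_monom_space)
    have "f (grassmann_monom K) * f (grassmann_monom L) \<in> monom_space ?P'"
      using gen[OF KL(5,3)] gen[OF KL(6,4)]
    proof (rule mult_in_monom_space)
      fix U V :: "'n set"
      assume UV: "U \<in> ?I' - {{}}" "V \<in> ?I' - {{}}" "U \<inter> V = {}"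
      have card: "card (U \<union> V) = card U + card V"
        using UV(3) by (simp add: card_Un_disjoint)
      have even_ge: "2 \<le> card W" if "even (card W)" "W \<noteq> {}" for W :: "'n set"
      proof -
        have "card W \<noteq> 0"
          using that(2) by simp
        then show ?thesis
          using that(1) by presburger
      qed
      have star_ge: "3 \<le> card W" if "W \<in> odd_star a - {{a}}" for W
      proof -
        have "odd (card W)" "card W \<noteq> 1"
          using that by (auto simp: odd_star_def card_1_singleton_iff)
        then show ?thesis by presburger
      qed
      have mixed: "W \<union> X \<in> ?P'" if WX: "W \<in> flipped_star a" "even (card X)" "X \<noteq> {}" "W \<inter> X = {}" for W X
      proof -
        have "W \<noteq> - {a}"
        proof
          assume "W = - {a}"
          then have "X = {a}"
            using WX by auto
          then show False
            using WX(2) by simp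
        qed
        then have W: "W \<in> odd_star a - {{a}}"
          using WX(1) by (simp add: flipped_star_def)
        have "card (W \<union> X) = card W + card X"
          using WX(4) by (simp add: card_Un_disjoint)
        then show ?thesis
          using star_ge[OF W] even_ge[OF WX(2,3)] W WX(2) by (simp add: odd_star_def)
      qed
      consider "even (card U)" "even (card V)" | "U \<in> flipped_star a" "even (card V)"
        | "even (card U)" "V \<in> flipped_star a" | "U \<in> flipped_star a" "V \<in> flipped_star a"
        using UV by blast
      then show "U \<union> V \<in> ?P'"
      proof cases
        case 1
        then show ?thesis
          using even_ge[of U] even_ge[of V] UV card by simp
      next
        case 2
        then show ?thesis
          using mixed[of U V] UV by simp
      next
        case 3
        then show ?thesis
          using mixed[of V U] UV by (simp add: Un_commute Int_commute)
      next
        case 4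
        then show ?thesis
          using flipped_star_system(1)[OF n, of a] UV(3) by (auto simp: odd_intersecting_system_def)
      qed
    qed
    also have "f (grassmann_monom K) * f (grassmann_monom L) = f (grassmann_monom K * grassmann_monom L)"
      by (rule f_mult[OF m, symmetric])
    also have "grassmann_monom K * grassmann_monom L = wedge_coeff K L *\<^sub>g grassmann_monom J"
      using KL(1,2) by (simp add: monom_mult)
    also have "f (wedge_coeff K L *\<^sub>g grassmann_monom J) = wedge_coeff K L *\<^sub>g f (grassmann_monom J)"
      by (rule f_scale) (use J in \<open>auto simp: monom_in_monom_space\<close>)
    finally have "inverse (wedge_coeff K L) *\<^sub>g wedge_coeff K L *\<^sub>g f (grassmann_monom J) \<in> monom_space ?P'"
      by (rule grassmann.subspace_scale[OF subspace_monom_space])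
    then show ?thesis
      using wedge_coeff_nonzero[OF KL(2)] by simp
  qed
  \<comment> \<open>Extending \<open>f\<close> by 0 on the remaining monomials makes it linear on the whole space.\<close>
  define g where "g x = f (monom_part ?I x)" for x
  have g_linear: "g (x + y) = g x + g y" "g (c *\<^sub>g x) = c *\<^sub>g g x" for x y c
    unfolding g_def monom_part_linear by (rule f_add f_scale, (rule monom_part_in)+)+
  have sub: "monom_space ?P \<subseteq> ?A"
    by (rule monom_space_mono) auto
  have g_eq: "g x = f x" if "x \<in> ?A" for x
    unfolding g_def monom_part_id[OF that] ..
  have "g x \<in> monom_space ?P'" if "x \<in> monom_space ?P" for x
    using that unfolding monom_space_eq_span[of ?P]
  proof (induction rule: grassmann.span_induct_alt)
    case base
    have "g 0 = 0"
      using g_linear(2)[of 0 0] by simp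
    then show ?case
      using grassmann.subspace_0[OF subspace_monom_space] by simp
  next
    case (step c m y)
    then obtain J where J: "m = grassmann_monom J" "J \<in> ?P" by blast
    then have "m \<in> ?A"
      using sub by (auto simp: monom_in_monom_space)
    then have "g m \<in> monom_space ?P'"
      using prod[OF J(2)] by (simp add: g_eq J(1))
    then show ?case
      unfolding g_linear using step.IH
      by (intro grassmann.subspace_add[OF subspace_monom_space] grassmann.subspace_scale[OF subspace_monom_space])
  qed
  then have "g ` monom_space ?P \<subseteq> monom_space ?P'"
    by (rule image_subsetI)
  then have "grassmann.dim (g ` monom_space ?P) \<le> card ?P'"
    by (rule fin.dim_subset[THEN order_trans]) (simp only: dim_monom_space order_refl)
  moreover have "grassmann.dim (g ` monom_space ?P) = card ?P"
  proof -
    interpret pair: finite_dimensional_vector_space_pair_1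
      "grassmann_scale :: 'a \<Rightarrow> ('a, 'n) grassmann \<Rightarrow> ('a, 'n) grassmann" "range grassmann_monom"
      "grassmann_scale :: 'a \<Rightarrow> ('a, 'n) grassmann \<Rightarrow> ('a, 'n) grassmann"
      by unfold_locales
    have "inj_on g (monom_space ?P)"
    proof
      fix x y assume xy: "x \<in> monom_space ?P" "y \<in> monom_space ?P" "g x = g y"
      then have "x \<in> ?A" "y \<in> ?A"
        using sub by auto
      moreover from this have "f x = f y"
        using xy(3) by (simp add: g_eq)
      ultimately show "x = y"
        using bij_betw_imp_inj_on[OF f] by (simp add: inj_on_eq_iff)
    qed
    moreover have "grassmann.span (monom_space ?P) = (monom_space ?P :: ('a, 'n) grassmann set)"
      by (rule grassmann.span_eq_iff[THEN iffD2, OF subspace_monom_space])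
    moreover have "Vector_Spaces.linear grassmann_scale grassmann_scale g"
      unfolding Vector_Spaces.linear_iff
      by (intro conjI allI g_linear grassmann.vector_space_axioms)
    ultimately have "grassmann.dim (g ` monom_space ?P) = grassmann.dim (monom_space ?P :: ('a, 'n) grassmann set)"
      by (intro pair.dim_image_eq) (simp_all only:)
    then show ?thesis
      by (simp only: dim_monom_space)
  qed
  moreover have "card ?P' < card ?P"
  proof (rule psubset_card_mono)
    have "2 \<le> card (- {a})"
      using n by (simp add: card_Compl_UNIV)
    then obtain L where L: "L \<subseteq> - {a}" "card L = 2"
      by (rule obtain_subset_with_card_n)
    then have "card (insert a L) = 3"
      by (subst card_insert_disjoint) auto
    then have "insert a L \<in> ?P" "insert a L \<notin> ?P'"
      by (simp_all add: odd_star_def)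
    then show "?P' \<subset> ?P"
      by auto
  qed simp
  ultimately show False
    by simp
qed

lemma nonisomorphic_maximal_exist:
  assumes n: "even CARD('n)" "CARD('n) > 2"
  shows "\<exists>(A :: ('a, 'n) grassmann set) B. maximal_commutative_subalgebra A \<and>
    maximal_commutative_subalgebra B \<and> \<not> isomorphic_subalgebras A B"
proof -
  note S = flipped_star_system[OF n, of undefined]
  have "card (flipped_star (undefined :: 'n)) = max_system_size CARD('n)"
    using S(3) card_odd_star[of "undefined :: 'n"] n by (simp add: max_system_size_def)
  then have "maximal_commutative_subalgebra
      (monom_space ({J. even (card J)} \<union> flipped_star undefined) :: ('a, 'n) grassmann set)"
    using monom_system_algebra[OF S(1,2)] by (intro max_dim_imp_maximal) simp_all
  then show ?thesis
    using star_algebra_maximal star_algebras_not_isomorphic[OF n] by blast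
qed

section \<open>Subalgebras of maximal dimension for an odd number of generators\<close>

lemma subspace_sum_pair:
  assumes "grassmann.subspace U" "grassmann.subspace V"
  shows "subspace_sum {U, V} = {u + v | u v. u \<in> U \<and> v \<in> (V :: ('a, 'n) grassmann set)}"
proof -
  have "subspace_sum {U, V} = grassmann.span (U \<union> V)"
    by (simp add: subspace_sum_def)
  then show ?thesis
    by (simp only: grassmann.span_Un grassmann.span_eq_iff[THEN iffD2, OF assms(1)]
        grassmann.span_eq_iff[THEN iffD2, OF assms(2)])
qed

lemma subspace_sum_triple:
  assumes "grassmann.subspace U" "grassmann.subspace V" "grassmann.subspace W"
  shows "subspace_sum {U, V, W} =
    {u + x | u x. u \<in> U \<and> x \<in> {v + w | v w. v \<in> V \<and> w \<in> (W :: ('a, 'n) grassmann set)}}"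
proof -
  have "subspace_sum {U, V, W} = grassmann.span (U \<union> (V \<union> W))"
    by (simp add: subspace_sum_def)
  then show ?thesis
    by (simp only: grassmann.span_Un grassmann.span_eq_iff[THEN iffD2, OF assms(1)]
        grassmann.span_eq_iff[THEN iffD2, OF assms(2)] grassmann.span_eq_iff[THEN iffD2, OF assms(3)])
qed

lemma arg_max_imp_maximal:
  "is_arg_max grassmann.dim commutative_subalgebra A \<Longrightarrow> maximal_commutative_subalgebra A"
  for A :: "('a, 'n) grassmann set"
  by (rule max_dim_imp_maximal) (simp_all add: is_arg_max_commutative_iff)

lemma odd_square_zero_module_upper: "odd_square_zero_module (monom_space upper_odd_sets)"
  by (rule odd_square_zero_module_monom_space[OF odd_intersecting_upper odd_upclosed_upper])

text \<open>
  The initial sets of the odd part form a largest odd intersecting system and so have size at least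
  \<open>(n - 1) / 2\<close>. Since \<open>n\<close> is odd, the sum of two odd sizes, one at least \<open>(n - 1) / 2\<close> and one above
  \<open>n / 2\<close>, exceeds \<open>n\<close>; so the odd elements of degree above \<open>n / 2\<close> annihilate the odd part and lie in
  it by maximality.
\<close>

lemma max_commutative_odd_part:
  assumes n: "odd CARD('n)" and A: "is_arg_max grassmann.dim commutative_subalgebra (A :: ('a, 'n) grassmann set)"
  shows "A \<inter> odd_space \<subseteq> monom_space {J. odd (card J) \<and> CARD('n) \<le> 2 * card J + 1}"
    and "monom_space upper_odd_sets \<subseteq> A \<inter> odd_space"
    and "grassmann.dim (A \<inter> odd_space) = max_system_size CARD('n)"
    and "A = with_even (A \<inter> odd_space)"
proof -
  let ?D = "A \<inter> odd_space"
  note max = arg_max_imp_maximal[OF A]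
  note A' = maximal_contains_even[OF max]
  note D = odd_part_of_commutative[OF A']
  note D' = odd_square_zero_moduleD[OF D(1)]
  show "A = with_even ?D" by (rule D(2))
  have "grassmann.dim A = 2 ^ (CARD('n) - 1) + grassmann.dim ?D"
    by (subst D(2)) (rule dim_with_even[OF D'(1,2)])
  then show dim: "grassmann.dim ?D = max_system_size CARD('n)"
    using A by (simp add: is_arg_max_commutative_iff)
  obtain F :: "'n set set" where F: "odd_intersecting_system F" "grassmann.dim ?D \<le> card F"
    "\<And>x J. x \<in> ?D \<Longrightarrow> gcoeff x J \<noteq> 0 \<Longrightarrow> \<exists>A\<in>F. card A \<le> card J"
    using square_zero_initial_system[OF D'(1-3)] by (metis (no_types, lifting))
  have large: "CARD('n) \<le> 2 * card B + 1" if "B \<in> F" for B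
    using card_odd_intersecting_le(2)[OF F(1) n that] F(2) dim by linarith
  show low: "?D \<subseteq> monom_space {J. odd (card J) \<and> CARD('n) \<le> 2 * card J + 1}"
  proof
    fix x assume x: "x \<in> ?D"
    show "x \<in> monom_space {J. odd (card J) \<and> CARD('n) \<le> 2 * card J + 1}"
      unfolding monom_space_def
    proof (intro CollectI allI impI conjI)
      fix J assume J: "gcoeff x J \<noteq> 0"
      show "odd (card J)"
        using x J by (auto simp: monom_space_def)
      obtain B where "B \<in> F" "card B \<le> card J"
        using F(3)[OF x J] by blast
      then show "CARD('n) \<le> 2 * card J + 1"
        using large[of B] by linarith
    qed
  qed
  have "d * u = 0" if "d \<in> ?D" "u \<in> monom_space upper_odd_sets" for d u
  proof (rule mult_eq_zero_if_meet)
    show "d \<in> monom_space {J. odd (card J) \<and> CARD('n) \<le> 2 * card J + 1}"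
      using low that(1) by blast
    show "u \<in> monom_space upper_odd_sets" by (rule that(2))
    fix J K :: "'n set"
    assume "J \<in> {J. odd (card J) \<and> CARD('n) \<le> 2 * card J + 1}" "K \<in> upper_odd_sets"
    then have "odd (card J)" "CARD('n) \<le> 2 * card J + 1" "odd (card K)" "CARD('n) < 2 * card K"
      by (auto simp: upper_odd_sets_def)
    then have "CARD('n) < card J + card K"
      using n by presburger
    then show "J \<inter> K \<noteq> {}"
      by (rule large_sets_meet)
  qed
  then have "monom_space upper_odd_sets \<subseteq> A"
    by (rule maximal_absorbs[OF max odd_square_zero_module_upper])
  then show "monom_space upper_odd_sets \<subseteq> ?D"
    using odd_square_zero_moduleD(2)[OF odd_square_zero_module_upper] by blast
qed

text \<open>
  Here \<open>(n - 1) / 2\<close> is even, so there is nothing of that degree in the odd part.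
\<close>

lemma arg_max_iff_1_mod_4:
  assumes n: "CARD('n) = 4 * k + 1"
  shows "is_arg_max grassmann.dim commutative_subalgebra (A :: ('a, 'n) grassmann set) \<longleftrightarrow>
    A = subspace_sum {grassmann_even, grassmann_upper_odd}"
proof -
  have sum: "subspace_sum {grassmann_even, grassmann_upper_odd} = with_even (monom_space upper_odd_sets)"
    unfolding grassmann_even_eq grassmann_upper_odd_eq
    by (rule subspace_sum_pair) (rule subspace_monom_space)+
  have card: "card (upper_odd_sets :: 'n set set) = max_system_size CARD('n)"
    unfolding max_system_size_1_mod_4[OF n] by (rule card_upper_odd_sets_1_mod_4[OF n])
  show ?thesis
    unfolding sum
  proof
    assume A: "is_arg_max grassmann.dim commutative_subalgebra A"
    have "odd CARD('n)"
      using n by simp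
    note max = max_commutative_odd_part[OF this A]
    have "{J :: 'n set. odd (card J) \<and> CARD('n) \<le> 2 * card J + 1} \<subseteq> upper_odd_sets"
      unfolding upper_odd_sets_def n by clarify presburger
    then have "A \<inter> odd_space \<subseteq> monom_space upper_odd_sets"
      using max(1) monom_space_mono by blast
    then have "A \<inter> odd_space = monom_space upper_odd_sets"
      using max(2) by (rule subset_antisym)
    with max(4) show "A = with_even (monom_space upper_odd_sets)"
      by simp
  next
    assume A: "A = with_even (monom_space upper_odd_sets)"
    then show "is_arg_max grassmann.dim commutative_subalgebra A"
      using commutative_subalgebra_with_even[OF odd_square_zero_module_upper]
        dim_with_even[OF odd_square_zero_moduleD(1,2)[OF odd_square_zero_module_upper]]
      by (simp add: is_arg_max_commutative_iff dim_monom_space card)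
  qed
qed

lemma dim_add_upper:
  assumes C: "grassmann.subspace C" "C \<subseteq> grassmann_hom m" "2 * m \<le> CARD('n)"
  shows "grassmann.dim {c + u | c u. c \<in> C \<and> u \<in> (monom_space upper_odd_sets :: ('a, 'n) grassmann set)} =
    grassmann.dim C + card (upper_odd_sets :: 'n set set)"
proof -
  have "C \<inter> monom_space upper_odd_sets \<subseteq> {0}"
  proof
    fix x assume x: "x \<in> C \<inter> monom_space upper_odd_sets"
    then have "x \<in> monom_space {J. card J = m}"
      using C(2) by (auto simp: grassmann_hom_eq)
    then have "gcoeff x J = 0" for J
      using x C(3) by (auto simp: monom_space_def upper_odd_sets_def)
    then show "x \<in> {0}"
      using grassmann_eqI[of x 0] by simp
  qed
  then have "grassmann.dim (C \<inter> monom_space upper_odd_sets) = 0"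
    by (simp only: fin.dim_eq_0)
  then show ?thesis
    using fin.dim_sums_Int[OF C(1) subspace_monom_space, of upper_odd_sets]
    by (simp only: dim_monom_space add_0_right)
qed

text \<open>
  The odd part of a largest algebra lies in degrees at least \<open>2 k + 1\<close> and contains everything odd of
  higher degree, so it is determined by its component \<open>C\<close> of degree \<open>2 k + 1\<close>. Conversely, an even
  element acts on \<open>C\<close> as a scalar up to terms of higher degree, so every square zero \<open>C\<close> of the right dimension works.
\<close>

lemma arg_max_iff_3_mod_4:
  assumes n: "CARD('n) = 4 * k + 3"
  shows "is_arg_max grassmann.dim commutative_subalgebra (A :: ('a, 'n) grassmann set) \<longleftrightarrow>
    (\<exists>C. square_zero_subspace C \<and> C \<subseteq> grassmann_hom (2 * k + 1) \<and>
      grassmann.dim C = (CARD('n) - 1) choose (2 * k) \<and>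
      A = subspace_sum {grassmann_even, C, grassmann_upper_odd})"
proof -
  let ?U = "monom_space upper_odd_sets :: ('a, 'n) grassmann set"
  have sum: "subspace_sum {grassmann_even, C, grassmann_upper_odd} =
      with_even {c + u | c u. c \<in> C \<and> u \<in> ?U}" if "grassmann.subspace C" for C
    unfolding grassmann_even_eq grassmann_upper_odd_eq
    by (rule subspace_sum_triple) (rule subspace_monom_space that)+
  have size: "max_system_size CARD('n) = ((CARD('n) - 1) choose (2 * k)) + card (upper_odd_sets :: 'n set set)"
    unfolding max_system_size_3_mod_4[OF n] card_upper_odd_sets_3_mod_4[OF n] ..
  have low: "2 * (2 * k + 1) \<le> CARD('n)"
    using n by simp
  show ?thesis
  proof
    assume A: "is_arg_max grassmann.dim commutative_subalgebra A"
    have "odd CARD('n)"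
      using n by simp
    note max = max_commutative_odd_part[OF this A]
    define C where "C = (A \<inter> odd_space) \<inter> grassmann_hom (2 * k + 1)"
    note D = odd_part_of_commutative(1)[OF maximal_contains_even[OF arg_max_imp_maximal[OF A]]]
    note D' = odd_square_zero_moduleD[OF D]
    have C: "grassmann.subspace C"
      unfolding C_def grassmann_hom_eq by (rule grassmann.subspace_inter[OF D'(1) subspace_monom_space])
    have "A \<inter> odd_space = {c + u | c u. c \<in> C \<and> u \<in> ?U}"
    proof (intro equalityI subsetI)
      fix x assume x: "x \<in> A \<inter> odd_space"
      let ?c = "monom_part (- upper_odd_sets) x" and ?u = "monom_part upper_odd_sets x"
      have xcu: "?c + ?u = x"
        by (rule monom_part_add) auto
      have u: "?u \<in> ?U"
        by (rule monom_part_in)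
      then have "x - ?u \<in> A \<inter> odd_space"
        using max(2) x by (intro grassmann.subspace_diff[OF D'(1)]) auto
      moreover have "x - ?u = ?c"
        using xcu by (metis add_diff_cancel_right')
      moreover have "?c \<in> grassmann_hom (2 * k + 1)"
        unfolding grassmann_hom_eq monom_space_def
      proof (intro CollectI allI impI)
        fix J assume "gcoeff ?c J \<noteq> 0"
        then have "J \<notin> upper_odd_sets" "gcoeff x J \<noteq> 0"
          by (auto simp: gcoeff_monom_part split: if_splits)
        moreover from this have "odd (card J) \<and> CARD('n) \<le> 2 * card J + 1"
          using max(1) x by (auto simp: monom_space_def)
        ultimately show "card J = 2 * k + 1"
          unfolding upper_odd_sets_def n by simp
      qed
      ultimately have "?c \<in> C"
        by (simp add: C_def)
      then show "x \<in> {c + u | c u. c \<in> C \<and> u \<in> ?U}"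
        using u xcu by (intro CollectI exI[of _ ?c] exI[of _ ?u]) simp
    next
      fix x assume "x \<in> {c + u | c u. c \<in> C \<and> u \<in> ?U}"
      then obtain c u where "x = c + u" "c \<in> A \<inter> odd_space" "u \<in> A \<inter> odd_space"
        using max(2) by (auto simp: C_def)
      then show "x \<in> A \<inter> odd_space"
        using grassmann.subspace_add[OF D'(1)] by blast
    qed
    note DC = this
    have "C \<subseteq> grassmann_hom (2 * k + 1)"
      unfolding C_def by (rule Int_lower2)
    moreover have "grassmann.dim C = (CARD('n) - 1) choose (2 * k)"
      using dim_add_upper[OF C \<open>C \<subseteq> grassmann_hom (2 * k + 1)\<close> low] max(3) size by (simp only: DC)
    moreover have "square_zero_subspace C"
      unfolding square_zero_subspace_def using C D'(3) by (simp add: C_def)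
    moreover have "A = subspace_sum {grassmann_even, C, grassmann_upper_odd}"
      unfolding sum[OF C] DC[symmetric] by (rule max(4))
    ultimately show "\<exists>C. square_zero_subspace C \<and> C \<subseteq> grassmann_hom (2 * k + 1) \<and>
        grassmann.dim C = (CARD('n) - 1) choose (2 * k) \<and>
        A = subspace_sum {grassmann_even, C, grassmann_upper_odd}"
      by blast
  next
    assume "\<exists>C. square_zero_subspace C \<and> C \<subseteq> grassmann_hom (2 * k + 1) \<and>
        grassmann.dim C = (CARD('n) - 1) choose (2 * k) \<and>
        A = subspace_sum {grassmann_even, C, grassmann_upper_odd}"
    then obtain C where C: "grassmann.subspace C" "\<And>c d. c \<in> C \<Longrightarrow> d \<in> C \<Longrightarrow> c * d = 0"
      "C \<subseteq> grassmann_hom (2 * k + 1)" "grassmann.dim C = (CARD('n) - 1) choose (2 * k)"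
      "A = subspace_sum {grassmann_even, C, grassmann_upper_odd}"
      unfolding square_zero_subspace_def by auto
    let ?M = "{J :: 'n set. card J = 2 * k + 1}"
    let ?D = "{c + u | c u. c \<in> C \<and> u \<in> ?U}"
    have CM: "C \<subseteq> monom_space ?M"
      using C(3) by (simp only: grassmann_hom_eq)
    have M_odd: "?M \<subseteq> {J. odd (card J)}"
      by auto
    note U = odd_square_zero_moduleD[OF odd_square_zero_module_upper]
    have CU: "c * u = 0" "u * c = 0" if "c \<in> C" "u \<in> ?U" for c u
    proof -
      have meet: "J \<inter> K \<noteq> {}" if "J \<in> ?M" "K \<in> upper_odd_sets" for J K :: "'n set"
      proof -
        have "odd (card K)" "4 * k + 3 < 2 * card K" "card J = 2 * k + 1"
          using that n by (auto simp: upper_odd_sets_def)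
        then have "CARD('n) < card J + card K"
          unfolding n by presburger
        then show ?thesis
          by (rule large_sets_meet)
      qed
      show "c * u = 0"
        using CM that meet by (intro mult_eq_zero_if_meet[of c ?M u upper_odd_sets]) auto
      then show "u * c = 0"
        using odd_anticommute[of u c] U(2) monom_space_mono[OF M_odd] CM that by auto
    qed
    have sub: "grassmann.subspace ?D"
      by (rule grassmann.subspace_sums[OF C(1) subspace_monom_space])
    have D: "odd_square_zero_module ?D"
      unfolding odd_square_zero_module_def square_zero_subspace_def
    proof (intro conjI ballI sub)
      show "?D \<subseteq> odd_space"
      proof
        fix x assume "x \<in> ?D"
        then obtain c u where "x = c + u" "c \<in> odd_space" "u \<in> odd_space"
          using U(2) monom_space_mono[OF M_odd] CM by blast
        then show "x \<in> odd_space"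
          using grassmann.subspace_add[OF subspace_monom_space] by simp
      qed
      show "x * y = 0" if xy: "x \<in> ?D" "y \<in> ?D" for x y
      proof -
        obtain c u where x: "x = c + u" "c \<in> C" "u \<in> ?U"
          using xy(1) by blast
        obtain c' u' where y: "y = c' + u'" "c' \<in> C" "u' \<in> ?U"
          using xy(2) by blast
        show ?thesis
          using x y by (simp add: distrib_left distrib_right C(2) U(3) CU)
      qed
      show "e * x \<in> ?D" if ex: "e \<in> even_space" "x \<in> ?D" for e x
      proof -
        obtain c u where x: "x = c + u" "c \<in> C" "u \<in> ?U"
          using ex(2) by blast
        \<comment> \<open>The constant term of \<open>e\<close> keeps \<open>c\<close> in \<open>C\<close>; the other terms raise its degree by at least 2.\<close>
        define s where "s = gcoeff e {}"
        define e' where "e' = e - s *\<^sub>g 1"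
        have "e' \<in> monom_space {J. even (card J) \<and> J \<noteq> {}}"
          using ex(1) by (auto simp: monom_space_def e'_def s_def gcoeff_one)
        moreover have "c \<in> monom_space ?M"
          using CM x(2) by blast
        ultimately have "e' * c \<in> ?U"
        proof (rule mult_in_monom_space)
          fix J K :: "'n set"
          assume JK: "J \<in> {J. even (card J) \<and> J \<noteq> {}}" "K \<in> ?M" "J \<inter> K = {}"
          then have "card (J \<union> K) = card J + (2 * k + 1)" "even (card J)" "card J \<noteq> 0"
            by (auto simp: card_Un_disjoint)
          then show "J \<union> K \<in> upper_odd_sets"
            unfolding upper_odd_sets_def n mem_Collect_eq by presburger
        qed
        then have "e' * c + e * u \<in> ?U"
          using U(4)[OF ex(1) x(3)] by (rule grassmann.subspace_add[OF subspace_monom_space])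
        moreover have "s *\<^sub>g c \<in> C"
          by (rule grassmann.subspace_scale[OF C(1) x(2)])
        moreover have "e * x = s *\<^sub>g c + (e' * c + e * u)"
          by (simp add: x(1) e'_def algebra_simps grassmann_scale_mult_left)
        ultimately show ?thesis by blast
      qed
    qed
    have "A = with_even ?D"
      unfolding C(5) by (rule sum[OF C(1)])
    moreover have "grassmann.dim ?D = max_system_size CARD('n)"
      using dim_add_upper[OF C(1,3) low] C(4) size by simp
    ultimately show "is_arg_max grassmann.dim commutative_subalgebra A"
      using commutative_subalgebra_with_even[OF D] dim_with_even[OF odd_square_zero_moduleD(1,2)[OF D]]
      by (simp only: is_arg_max_commutative_iff simp_thms)
  qed
qed


end


section \<open>Commutative subalgebras of the Grassmann algebra\<close>

lemma two_neq_zero_if_CHAR: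
  assumes "CHAR('a::field) \<noteq> 2"
  shows "(2::'a) \<noteq> 0"
proof
  assume "(2::'a) = 0"
  then have "of_nat 2 = (0::'a)"
    by simp
  then have "CHAR('a) dvd 2"
    by (simp only: of_nat_eq_0_iff_char_dvd)
  then have "CHAR('a) = 1"
    using assms by (metis prime_nat_iff two_is_prime_nat)
  then have "of_nat 1 = (0::'a)"
    by (simp only: of_nat_eq_0_iff_char_dvd one_dvd)
  then show False
    by simp
qed

theorem theorem7p1:
  fixes n k :: nat
  assumes char_neq_2: "CHAR('a::field) \<noteq> 2"
    and n: "n = CARD('n::{finite,linorder})"
    and k: "k = n div 4"
  shows "
    \<comment> \<open>(i)\<close>
    ((\<exists>A :: ('a, 'n) grassmann set. is_arg_max grassmann.dim commutative_subalgebra A)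
     \<and> (\<forall>A :: ('a, 'n) grassmann set. is_arg_max grassmann.dim commutative_subalgebra A \<longrightarrow>
          (\<forall>F :: 'n set set. is_arg_max card odd_intersecting_system F \<longrightarrow>
             grassmann.dim A = grassmann.dim (grassmann_even :: ('a, 'n) grassmann set) + card F)
          \<and> (even n \<longrightarrow> grassmann.dim A = 3 * 2 ^ (n - 2))
          \<and> (n = 4 * k + 1 \<longrightarrow>
               grassmann.dim A = 2 ^ (n - 1) + (\<Sum>l = k..2 * k. n choose (2 * l + 1)))
          \<and> (n = 4 * k + 3 \<longrightarrow>
               grassmann.dim A =
                 2 ^ (n - 1) + ((n - 1) choose (2 * k)) + (\<Sum>l = k..2 * k. n choose (2 * l + 3)))))
    \<and>
    \<comment> \<open>(ii)\<close>
    (even n \<longrightarrow>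
       (\<forall>(A :: ('a, 'n) grassmann set) (B :: ('a, 'n) grassmann set).
          maximal_commutative_subalgebra A \<longrightarrow> maximal_commutative_subalgebra B \<longrightarrow>
          grassmann.dim A = grassmann.dim B)
       \<and> (n > 2 \<longrightarrow>
            (\<exists>(A :: ('a, 'n) grassmann set) (B :: ('a, 'n) grassmann set).
               maximal_commutative_subalgebra A \<and> maximal_commutative_subalgebra B
               \<and> \<not> isomorphic_subalgebras A B)))
    \<and>
    \<comment> \<open>(iii)\<close>
    (n = 4 * k + 1 \<longrightarrow>
       (\<forall>A :: ('a, 'n) grassmann set.
          is_arg_max grassmann.dim commutative_subalgebra A \<longleftrightarrow>
          A = subspace_sum {grassmann_even, grassmann_upper_odd}))
    \<and>
    \<comment> \<open>(iv)\<close>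
    (n = 4 * k + 3 \<longrightarrow>
       (\<forall>A :: ('a, 'n) grassmann set.
          is_arg_max grassmann.dim commutative_subalgebra A \<longleftrightarrow>
          (\<exists>C. square_zero_subspace C \<and> C \<subseteq> grassmann_hom (2 * k + 1)
             \<and> grassmann.dim C = (n - 1) choose (2 * k)
             \<and> A = subspace_sum {grassmann_even, C, grassmann_upper_odd})))
    \<and>
    \<comment> \<open>(v); for n = 1 and n = 3 every maximal commutative subalgebra has maximal dimension\<close>
    (odd n \<and> n \<ge> 5 \<longrightarrow>
       (\<exists>A :: ('a, 'n) grassmann set.
          maximal_commutative_subalgebra A
          \<and> \<not> is_arg_max grassmann.dim commutative_subalgebra A))"
proof -
  interpret grassmann_char_neq_2 "TYPE('a \<times> 'n)"
    by unfold_locales (rule two_neq_zero_if_CHAR[OF char_neq_2])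
  note arg_max_iff = is_arg_max_commutative_iff
  show ?thesis
    unfolding n
  proof (intro conjI allI impI)
    show "\<exists>A :: ('a, 'n) grassmann set. is_arg_max grassmann.dim commutative_subalgebra A"
      using max_commutative_exists unfolding arg_max_iff .
  next
    fix A :: "('a, 'n) grassmann set" and F :: "'n set set"
    assume "is_arg_max grassmann.dim commutative_subalgebra A" "is_arg_max card odd_intersecting_system F"
    then show "grassmann.dim A = grassmann.dim (grassmann_even :: ('a, 'n) grassmann set) + card F"
      by (simp only: arg_max_iff max_odd_intersecting_card grassmann_even_eq dim_even_space)
  next
    fix A :: "('a, 'n) grassmann set"
    assume "is_arg_max grassmann.dim commutative_subalgebra A" "even CARD('n)"
    then show "grassmann.dim A = 3 * 2 ^ (CARD('n) - 2)"
      by (simp only: arg_max_iff max_dim_even)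
  next
    fix A :: "('a, 'n) grassmann set"
    assume "is_arg_max grassmann.dim commutative_subalgebra A" "CARD('n) = 4 * k + 1"
    then show "grassmann.dim A = 2 ^ (CARD('n) - 1) + (\<Sum>l = k..2 * k. CARD('n) choose (2 * l + 1))"
      using max_system_size_1_mod_4[of "CARD('n)" k] by (simp only: arg_max_iff)
  next
    fix A :: "('a, 'n) grassmann set"
    assume "is_arg_max grassmann.dim commutative_subalgebra A" "CARD('n) = 4 * k + 3"
    then show "grassmann.dim A = 2 ^ (CARD('n) - 1) + ((CARD('n) - 1) choose (2 * k))
        + (\<Sum>l = k..2 * k. CARD('n) choose (2 * l + 3))"
      using max_system_size_3_mod_4[of "CARD('n)" k] by (simp only: arg_max_iff add.assoc)
  next
    fix A B :: "('a, 'n) grassmann set"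
    assume "even CARD('n)" "maximal_commutative_subalgebra A" "maximal_commutative_subalgebra B"
    then show "grassmann.dim A = grassmann.dim B"
      by (simp only: dim_maximal_even)
  next
    assume "even CARD('n)" "2 < CARD('n)"
    then show "\<exists>(A :: ('a, 'n) grassmann set) B :: ('a, 'n) grassmann set.
        maximal_commutative_subalgebra A \<and> maximal_commutative_subalgebra B \<and> \<not> isomorphic_subalgebras A B"
      by (rule nonisomorphic_maximal_exist)
  next
    fix A :: "('a, 'n) grassmann set"
    assume "CARD('n) = 4 * k + 1"
    then show "is_arg_max grassmann.dim commutative_subalgebra A \<longleftrightarrow>
        A = subspace_sum {grassmann_even, grassmann_upper_odd}"
      by (rule arg_max_iff_1_mod_4)
  next
    fix A :: "('a, 'n) grassmann set"
    assume "CARD('n) = 4 * k + 3"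
    then show "is_arg_max grassmann.dim commutative_subalgebra A \<longleftrightarrow>
        (\<exists>C. square_zero_subspace C \<and> C \<subseteq> grassmann_hom (2 * k + 1)
           \<and> grassmann.dim C = (CARD('n) - 1) choose (2 * k)
           \<and> A = subspace_sum {grassmann_even, C, grassmann_upper_odd})"
      by (rule arg_max_iff_3_mod_4)
  next
    assume "odd CARD('n) \<and> CARD('n) \<ge> 5"
    then show "\<exists>A :: ('a, 'n) grassmann set. maximal_commutative_subalgebra A
        \<and> \<not> is_arg_max grassmann.dim commutative_subalgebra A"
      using star_algebra_maximal star_algebra_not_max by blast
  qed
qed

end
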